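(* Let $p=1/2$ and $c=\pi^{2}/3$. For all $t\in\mathbb R$, \[ \lim_{N\to\infty}\mathbb P\left(\frac{1}{\sqrt{cN}}\log X_N\le t\right)=\begin{cases}0,&\text{if } t\le 0,\\ t^2,&\text{if } 0\le t\le 1,\\ 1,&\text{if } t\ge 1.\end{cases} \]
   Context: Let $p\in[0,1]$. For $N\ge 1$ let $\mathcal T$ be the full binary tree of depth $N$, where depth is counted so that the tree of depth $1$ is a single vertex (which is both root and leaf) and the root of the tree of depth $N+1$ has two children, each the root of a full binary tree of depth $N$. Let $\{\eta_v\}_{v\in\mathcal T}$ be independent random variables with $\mathbb P(\eta_v=1)=1-\mathbb P(\eta_v=-1)=p$. Define $X_v$ recursively from the leaves: $X_v=1$ if $v$ is a leaf; if $w$ has children $v_1,v_2$, then $X_w=X_{v_1}+X_{v_2}$ if $\eta_w=1$ and $X_w=\min(X_{v_1},X_{v_2})$ if $\eta_w=-1$. Set $X_N:=X_{root}$. Here $\log$ is the natural logarithm. *)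

theory Defs
  imports "HOL-Probability.Probability"
begin

(* A vertex is the path leading to it from the root, so the root is [], the children of w
   are w @ [False] and w @ [True], and the leaves are the paths of length N - 1. *)
definition tree :: "nat \<Rightarrow> bool list set" where
  "tree N = {v. length v < N}"

(* The value at v of the tree of depth N under the signs e.
   Only the values of e at non-leaf vertices of tree N matter for v \<in> tree N. *)
function tree_value :: "nat \<Rightarrow> (bool list \<Rightarrow> int) \<Rightarrow> bool list \<Rightarrow> nat" where
  "tree_value N e v =
     (if N \<le> Suc (length v) then 1
      else if e v = 1 then tree_value N e (v @ [False]) + tree_value N e (v @ [True])
      else min (tree_value N e (v @ [False])) (tree_value N e (v @ [True])))"
  by pat_completeness auto
termination
  by (relation "Wellfounded.measure (\<lambda>(N, e, v). N - length v)") auto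

declare tree_value.simps [simp del]

locale random_signs = prob_space M
  for M :: "'a measure" +
  fixes p :: real and N :: nat and \<eta> :: "bool list \<Rightarrow> 'a \<Rightarrow> int"
  assumes p_range: "0 \<le> p" "p \<le> 1"
    and indep: "indep_vars (\<lambda>_. count_space UNIV) \<eta> (tree N)"
    and prob_plus: "v \<in> tree N \<Longrightarrow> \<P>(\<omega> in M. \<eta> v \<omega> = 1) = p"
    and prob_minus: "v \<in> tree N \<Longrightarrow> \<P>(\<omega> in M. \<eta> v \<omega> = -1) = 1 - p"

definition root_value :: "nat \<Rightarrow> (bool list \<Rightarrow> 'a \<Rightarrow> int) \<Rightarrow> 'a \<Rightarrow> nat" where
  "root_value N \<eta> \<omega> = tree_value N (\<lambda>v. \<eta> v \<omega>) []"

end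

theory Submission
  imports Defs "HOL-Real_Asymp.Real_Asymp"
begin

text \<open>
  Write \<open>F\<^sub>n\<close> for the distribution function of the root value of a tree with \<open>n + 1\<close> levels. Then
  \<open>F\<^sub>n\<^sub>+\<^sub>1 = F\<^sub>n - F\<^sub>n\<^sup>2/2 + S(F\<^sub>n)/2\<close>, where \<open>S(F)\<close> is the distribution function of the sum of two
  independent copies, and this recursion is monotone in \<open>F\<^sub>n\<close>. For \<open>G(x) = H(ln x)\<close> with a slowly
  varying density \<open>h = H'\<close>, a sum exceeds \<open>x = exp y\<close> while its two summands do not with
  probability \<open>G(x)\<^sup>2 - S(G)(x)\<close>, which is close to
  \<open>h(y)\<^sup>2\<close> times the integral of \<open>- ln (1 - w) / w\<close> over \<open>[0, 1]\<close>, that is \<open>h(y)\<^sup>2 \<pi>\<^sup>2/6\<close>. So \<open>H\<close>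
  approximately solves \<open>\<partial>\<^sub>N H = - (\<pi>\<^sup>2/12) (\<partial>\<^sub>y H)\<^sup>2\<close>, whose self-similar solution is
  \<open>y\<^sup>2 / (c N)\<close> with \<open>c = \<pi>\<^sup>2/3\<close>. Replacing \<open>c\<close> by a slightly smaller or larger \<open>a\<close> turns this
  into a supersolution or a subsolution of the exact recursion: above, after shifting \<open>y\<close> by a
  large constant, so that only large \<open>y\<close> matter; below, after bending \<open>y\<^sup>2 / (a N)\<close> to an
  exponential approach to its limit, since \<open>S\<close> moves mass beyond any bounded support.
\<close>

section \<open>The law of the root value\<close>

text \<open>The law is given by its own recursion, free of any probability space, because the trees
  of different depths live on unrelated spaces. Index \<open>n\<close> belongs to
  \<open>n + 1\<close> levels, so the values are at most \<open>2^n\<close>.\<close>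

primrec root_law :: "nat \<Rightarrow> nat \<Rightarrow> real" where
  "root_law 0 k = of_bool (k = 1)"
| "root_law (Suc n) k =
     (\<Sum>i\<le>2^n. \<Sum>j\<le>2^n. root_law n i * root_law n j * ((of_bool (i + j = k) + of_bool (min i j = k)) / 2))"

definition root_cdf :: "nat \<Rightarrow> real \<Rightarrow> real" where
  "root_cdf n x = (\<Sum>k\<le>2^n. root_law n k * of_bool (real k \<le> x))"

lemma root_law_nonneg: "0 \<le> root_law n k"
  by (induction n arbitrary: k) (auto intro!: sum_nonneg)

lemma root_law_0 [simp]: "root_law n 0 = 0"
proof (induction n)
  case (Suc n)
  have "root_law n i * root_law n j * ((of_bool (i + j = 0) + of_bool (min i j = 0)) / 2) = 0" for i j
    using Suc by (cases "i = 0"; cases "j = 0") auto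
  then show ?case by (simp only: root_law.simps sum.neutral_const)
qed simp

text \<open>Expectation of a test function \<open>f\<close> after one more level: a constant
  \<open>f\<close> gives the total mass, an indicator gives the recursion for
  \<open>root_cdf\<close>.\<close>

lemma sum_root_law_Suc:
  "(\<Sum>k\<le>2^Suc n. root_law (Suc n) k * f k) =
     (\<Sum>i\<le>2^n. \<Sum>j\<le>2^n. root_law n i * root_law n j * ((f (i + j) + f (min i j)) / 2))"
proof -
  have ob: "(\<Sum>k\<le>2^Suc n. of_bool (m = k) * f k) = f m" if "m \<le> 2^Suc n" for m :: nat
    using sum.delta'[of "{..2^Suc n}" m f] that
    by (simp add: of_bool_def if_distribR if_distrib [where f = "\<lambda>z. z * _"] cong: if_cong)
  have "(\<Sum>k\<le>2^Suc n. root_law (Suc n) k * f k) =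
     (\<Sum>k\<le>2^Suc n. \<Sum>i\<le>2^n. \<Sum>j\<le>2^n. root_law n i * root_law n j * ((of_bool (i + j = k) * f k + of_bool (min i j = k) * f k) / 2))"
    by (simp only: root_law.simps sum_distrib_right mult.assoc times_divide_eq_left distrib_right)
  also have "\<dots> = (\<Sum>i\<le>2^n. \<Sum>k\<le>2^Suc n. \<Sum>j\<le>2^n. root_law n i * root_law n j * ((of_bool (i + j = k) * f k + of_bool (min i j = k) * f k) / 2))"
    by (rule sum.swap)
  also have "\<dots> = (\<Sum>i\<le>2^n. \<Sum>j\<le>2^n. \<Sum>k\<le>2^Suc n. root_law n i * root_law n j * ((of_bool (i + j = k) * f k + of_bool (min i j = k) * f k) / 2))"
    by (intro sum.cong refl sum.swap)
  also have "\<dots> = (\<Sum>i\<le>2^n. \<Sum>j\<le>2^n. root_law n i * root_law n j * ((f (i + j) + f (min i j)) / 2))"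
  proof (intro sum.cong refl)
    fix i j :: nat assume "i \<in> {..2^n}" "j \<in> {..2^n}"
    then have "i + j \<le> 2^Suc n" "min i j \<le> 2^Suc n" by auto
    then show "(\<Sum>k\<le>2^Suc n. root_law n i * root_law n j * ((of_bool (i + j = k) * f k + of_bool (min i j = k) * f k) / 2))
      = root_law n i * root_law n j * ((f (i + j) + f (min i j)) / 2)"
      unfolding sum_distrib_left [symmetric] sum_divide_distrib [symmetric] sum.distrib
      by (simp only: ob)
  qed
  finally show ?thesis .
qed

lemma sum_root_law: "(\<Sum>k\<le>2^n. root_law n k) = 1"
proof (induction n)
  case 0
  have "{..1::nat} = {0, 1}" by auto
  then show ?case by simp
next
  case (Suc n)
  have "(\<Sum>k\<le>2^Suc n. root_law (Suc n) k * 1) = (\<Sum>i\<le>2^n. root_law n i) * (\<Sum>j\<le>2^n. root_law n j)"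
    unfolding sum_root_law_Suc by (simp add: sum_product)
  then show ?case using Suc by simp
qed

lemma root_cdf_nonneg: "0 \<le> root_cdf n x"
  by (auto simp: root_cdf_def root_law_nonneg intro!: sum_nonneg)

lemma root_cdf_le_1: "root_cdf n x \<le> 1"
proof -
  have "root_cdf n x \<le> (\<Sum>k\<le>2^n. root_law n k)"
    unfolding root_cdf_def by (intro sum_mono) (auto simp: root_law_nonneg)
  then show ?thesis by (simp add: sum_root_law)
qed

lemma root_cdf_mono: "x \<le> y \<Longrightarrow> root_cdf n x \<le> root_cdf n y"
  unfolding root_cdf_def by (intro sum_mono mult_left_mono) (auto simp: root_law_nonneg)

lemma root_cdf_less_1: "root_cdf n x = 0" if "x < 1"
  unfolding root_cdf_def
proof (intro sum.neutral ballI)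
  fix k show "root_law n k * of_bool (real k \<le> x) = 0"
    using that by (cases "k = 0") auto
qed

lemma root_cdf_0: "root_cdf 0 x = of_bool (1 \<le> x)"
proof -
  have "{..1::nat} = {0, 1}" by auto
  then show ?thesis by (simp add: root_cdf_def)
qed

lemma root_cdf_Suc:
  "root_cdf (Suc n) x = root_cdf n x - (root_cdf n x)\<^sup>2 / 2 + (\<Sum>k\<le>2^n. root_law n k * root_cdf n (x - real k)) / 2"
proof -
  let ?b = "\<lambda>k::nat. of_bool (real k \<le> x) :: real"
  let ?A = "{..2^n} :: nat set"
  \<comment> \<open>Inclusion-exclusion: a minimum is at most \<open>x\<close> iff one of the two
    values is. This produces the term \<open>F - F^2/2\<close>.\<close>
  have 1: "?b (min i j) = ?b i + ?b j - ?b i * ?b j" for i j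
    by (auto simp: of_bool_def min_def)
  have "root_cdf (Suc n) x = (\<Sum>i\<in>?A. \<Sum>j\<in>?A. root_law n i * root_law n j * ((?b (i + j) + ?b (min i j)) / 2))"
    unfolding root_cdf_def by (rule sum_root_law_Suc)
  also have "\<dots> = (\<Sum>i\<in>?A. \<Sum>j\<in>?A. root_law n i * (root_law n j * of_bool (real j \<le> x - real i)) / 2
      + (root_law n i * ?b i) * root_law n j / 2 + root_law n i * (root_law n j * ?b j) / 2
      - (root_law n i * ?b i) * (root_law n j * ?b j) / 2)"
    by (intro sum.cong refl) (simp add: 1 le_diff_eq add_ac field_simps)
  also have "\<dots> = (\<Sum>i\<in>?A. root_law n i * root_cdf n (x - real i)) / 2
     + root_cdf n x * (\<Sum>j\<in>?A. root_law n j) / 2 + (\<Sum>j\<in>?A. root_law n j) * root_cdf n x / 2 - root_cdf n x * root_cdf n x / 2"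
    unfolding root_cdf_def
    by (simp only: sum.distrib sum_subtractf sum_divide_distrib [symmetric]
        sum_distrib_left [symmetric] sum_distrib_right [symmetric])
  finally show ?thesis by (simp add: sum_root_law power2_eq_square)
qed

section \<open>Locality, measurability and size of the values in a fixed tree\<close>

lemma tree_value_leaf: "N \<le> Suc (length v) \<Longrightarrow> tree_value N e v = 1"
  by (simp add: tree_value.simps)

lemma tree_value_pos: "1 \<le> tree_value N e v"
  by (induction N e v rule: tree_value.induct) (subst tree_value.simps, auto)

definition subtree :: "nat \<Rightarrow> bool list \<Rightarrow> bool list set" where
  "subtree N v = {v @ u | u. length (v @ u) < N}"

lemma subtree_child: "subtree N (v @ [b]) \<subseteq> subtree N v"
  by (auto simp: subtree_def)

text \<open>Allows the signs to be restricted to a subtree, which turns independence of the signs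
  into independence of the values at the two children.\<close>

lemma tree_value_cong:
  "(\<And>u. u \<in> subtree N v \<Longrightarrow> e u = e' u) \<Longrightarrow> tree_value N e v = tree_value N e' v"
proof (induction N e v rule: tree_value.induct)
  case (1 N e v)
  show ?case
  proof (cases "N \<le> Suc (length v)")
    case False
    have eq: "tree_value N e (v @ [b]) = tree_value N e' (v @ [b])" for b
    proof -
      have "\<And>u. u \<in> subtree N (v @ [b]) \<Longrightarrow> e u = e' u"
        using "1.prems" subtree_child by blast
      then show ?thesis using "1.IH" False by (cases b; cases "e v = 1") auto
    qed
    have "e v = e' v" using False by (intro "1.prems") (auto simp: subtree_def)
    then show ?thesis by (subst (1 2) tree_value.simps) (simp add: eq)
  qed (simp add: tree_value_leaf)
qed

text \<open>All values are discrete: freeze \<open>x\<close> and \<open>y\<close>, then release them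
  one after the other over their countably many values.\<close>

lemma measurable_countable_combine:
  fixes f :: "'i::countable \<Rightarrow> 'j::countable \<Rightarrow> 'k::countable \<Rightarrow> 'b"
  assumes "x \<in> measurable M (count_space UNIV)" "y \<in> measurable M (count_space UNIV)"
    and "z \<in> measurable M (count_space UNIV)"
  shows "(\<lambda>\<omega>. f (x \<omega>) (y \<omega>) (z \<omega>)) \<in> measurable M (count_space UNIV)"
proof -
  have "(\<lambda>\<omega>. f i j (z \<omega>)) \<in> measurable M (count_space UNIV)" for i j
    using assms(3) by (rule measurable_compose) simp
  then have "(\<lambda>\<omega>. f i (y \<omega>) (z \<omega>)) \<in> measurable M (count_space UNIV)" for i
    by (rule measurable_compose_countable [where f = "\<lambda>j \<omega>. f i j (z \<omega>)"]) (rule assms)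
  then show ?thesis
    by (rule measurable_compose_countable [where f = "\<lambda>i \<omega>. f i (y \<omega>) (z \<omega>)"]) (rule assms)
qed

lemma measurable_tree_value:
  assumes "subtree N v \<subseteq> K"
  shows "(\<lambda>e. tree_value N e v) \<in> measurable (PiM K (\<lambda>_. count_space UNIV)) (count_space UNIV)"
  using assms
proof (induction "N - length v" arbitrary: v)
  case 0
  then show ?case by (simp add: tree_value_leaf)
next
  case (Suc n)
  show ?case
  proof (cases "N \<le> Suc (length v)")
    case False
    have m: "(\<lambda>e. tree_value N e (v @ [b])) \<in> measurable (PiM K (\<lambda>_. count_space UNIV)) (count_space UNIV)" for b
      using Suc.hyps(2) Suc.prems subtree_child [of N v b] by (intro Suc.hyps(1)) auto
    have "v \<in> K" using Suc.prems False by (auto simp: subtree_def)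
    then have e: "(\<lambda>e. e v) \<in> measurable (PiM K (\<lambda>_. count_space UNIV)) (count_space UNIV)"
      by (rule measurable_component_singleton)
    show ?thesis
      using False measurable_countable_combine
        [OF e m [of False] m [of True], of "\<lambda>s i j. if s = 1 then i + j else min i j"]
      by (subst tree_value.simps) simp
  qed (simp add: tree_value_leaf)
qed

lemma tree_value_le: "length v < N \<Longrightarrow> tree_value N e v \<le> 2 ^ (N - Suc (length v))"
proof (induction N e v rule: tree_value.induct)
  case (1 N e v)
  show ?case
  proof (cases "N \<le> Suc (length v)")
    case False
    then obtain m where m: "N - Suc (length v) = Suc m" "N - Suc (Suc (length v)) = m"
      by (metis Suc_diff_Suc not_le)
    have "tree_value N e (v @ [b]) \<le> 2 ^ m" for b
      using "1.IH" False m by (cases b; cases "e v = 1") auto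
    from this [of False] this [of True] show ?thesis
      using False m by (subst tree_value.simps) (auto simp: min_def)
  qed (simp add: tree_value_leaf)
qed

section \<open>The random tree has law \<open>root_law\<close>\<close>

context random_signs
begin

text \<open>The three variables read the signs on disjoint sets of vertices: \<open>v\<close> itself
  and the two subtrees below it. The index \<open>None\<close> stands for the sign at
  \<open>v\<close>, coded as 0 or 1 so that all three share the type \<open>nat\<close>.\<close>

lemma indep_children:
  assumes v: "v \<in> tree N"
  shows "indep_vars (\<lambda>_. count_space UNIV)
    (\<lambda>c \<omega>. case c of None \<Rightarrow> of_bool (\<eta> v \<omega> = 1) | Some b \<Rightarrow> tree_value N (\<lambda>u. \<eta> u \<omega>) (v @ [b])) UNIV"
proof -
  define K where "K c = (case c of None \<Rightarrow> {v} | Some b \<Rightarrow> subtree N (v @ [b]))" for c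
  define Y :: "bool option \<Rightarrow> (bool list \<Rightarrow> int) \<Rightarrow> nat"
    where "Y c e = (case c of None \<Rightarrow> of_bool (e v = 1) | Some b \<Rightarrow> tree_value N e (v @ [b]))" for c e
  have "indep_vars (\<lambda>c. PiM (K c) (\<lambda>_. count_space UNIV)) (\<lambda>c \<omega>. restrict (\<lambda>u. \<eta> u \<omega>) (K c)) UNIV"
  proof (rule indep_vars_restrict [OF indep])
    show "K c \<subseteq> tree N" for c
      using v by (auto simp: K_def subtree_def tree_def split: option.splits)
    show "disjoint_family_on K UNIV"
      by (auto simp: disjoint_family_on_def K_def subtree_def split: option.splits)
  qed
  moreover have "Y c \<in> measurable (PiM (K c) (\<lambda>_. count_space UNIV)) (count_space UNIV)" for c
  proof (cases c)
    case None
    have "(\<lambda>e. e v) \<in> measurable (PiM {v} (\<lambda>_. count_space UNIV)) (count_space UNIV)"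
      by (rule measurable_component_singleton) simp
    from measurable_compose [OF this, of "\<lambda>s. of_bool (s = 1)"] show ?thesis
      by (simp add: None Y_def [abs_def] K_def)
  qed (simp add: Y_def [abs_def] K_def measurable_tree_value)
  ultimately have "indep_vars (\<lambda>_. count_space UNIV) (\<lambda>c. Y c \<circ> (\<lambda>\<omega>. restrict (\<lambda>u. \<eta> u \<omega>) (K c))) UNIV"
    by (rule indep_vars_compose)
  moreover have "Y c (restrict (\<lambda>u. \<eta> u \<omega>) (K c)) =
      (case c of None \<Rightarrow> of_bool (\<eta> v \<omega> = 1) | Some b \<Rightarrow> tree_value N (\<lambda>u. \<eta> u \<omega>) (v @ [b]))" for c \<omega>
    by (cases c) (auto simp: Y_def K_def intro: tree_value_cong)
  ultimately show ?thesis by (simp add: o_def)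
qed

text \<open>Split by the sign at \<open>v\<close> and the values at its children. The event is a
  finite disjoint union of triples, and by independence each triple has probability 1/2 times the
  product of the two children's masses.\<close>

lemma prob_tree_value:
  assumes p: "p = 1 / 2" and "v \<in> tree N" and "N = Suc (length v + n)"
  shows "\<P>(\<omega> in M. tree_value N (\<lambda>u. \<eta> u \<omega>) v = k) = root_law n k"
  using assms(2,3)
proof (induction n arbitrary: v k)
  case 0
  then show ?case by (auto simp: tree_value_leaf prob_space)
next
  case (Suc n)
  define Z where "Z c \<omega> = (case c of None \<Rightarrow> of_bool (\<eta> v \<omega> = 1)
    | Some b \<Rightarrow> tree_value N (\<lambda>u. \<eta> u \<omega>) (v @ [b]))" for c \<omega>
  define A where "A t = (case t of (s, i, j) \<Rightarrow>
    {\<omega> \<in> space M. Z None \<omega> = s \<and> Z (Some False) \<omega> = i \<and> Z (Some True) \<omega> = j})" for t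
  define q where "q s i j = (if s = 1 then i + j else min i j :: nat)" for s i j :: nat
  have ind: "indep_vars (\<lambda>_. count_space UNIV) Z UNIV"
    using indep_children [OF Suc.prems(1)] by (simp add: Z_def [abs_def])
  then have meas: "Z c \<in> measurable M (count_space UNIV)" for c
    by (auto simp: indep_vars_def)
  have child: "prob {\<omega> \<in> space M. Z (Some b) \<omega> = i} = root_law n i" for b i
    unfolding Z_def option.case using Suc.prems by (intro Suc.IH) (auto simp: tree_def)
  have "Z None \<omega> = 1 \<longleftrightarrow> \<eta> v \<omega> = 1" for \<omega>
    by (simp add: Z_def)
  then have sgn1: "prob {\<omega> \<in> space M. Z None \<omega> = 1} = 1 / 2"
    using prob_plus [OF Suc.prems(1)] p by simp
  have "{\<omega> \<in> space M. Z None \<omega> = 0} = space M - {\<omega> \<in> space M. Z None \<omega> = 1}"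
    by (auto simp: Z_def)
  then have sgn0: "prob {\<omega> \<in> space M. Z None \<omega> = 0} = 1 / 2"
    using sgn1 meas [of None] by (simp add: prob_compl)
  have A: "prob (A (s, i, j)) = (1 / 2) * (root_law n i * root_law n j)" if "s \<in> {0, 1}" for s i j
  proof -
    have "A (s, i, j) = (\<Inter>c\<in>UNIV. Z c -` {case c of None \<Rightarrow> s | Some b \<Rightarrow> if b then j else i} \<inter> space M)"
      by (auto simp: A_def UNIV_option_conv UNIV_bool)
    also have "prob \<dots> = (\<Prod>c\<in>UNIV. prob (Z c -` {case c of None \<Rightarrow> s | Some b \<Rightarrow> if b then j else i} \<inter> space M))"
      by (rule indep_varsD_finite [OF ind]) auto
    also have "\<dots> = prob {\<omega> \<in> space M. Z None \<omega> = s} * (prob {\<omega> \<in> space M. Z (Some False) \<omega> = i}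
       * prob {\<omega> \<in> space M. Z (Some True) \<omega> = j})"
      by (simp add: UNIV_option_conv UNIV_bool vimage_def Collect_conj_eq Int_commute)
    finally show ?thesis using that sgn0 sgn1 child by auto
  qed
  \<comment> \<open>Finitely many triples suffice, since the children's values are at most
    \<open>2^n\<close>.\<close>
  let ?T = "{0, 1 :: nat} \<times> {..2^n :: nat} \<times> {..2^n :: nat}"
  let ?S = "{t \<in> ?T. case t of (s, i, j) \<Rightarrow> q s i j = k}"
  have root_eq: "tree_value N (\<lambda>u. \<eta> u \<omega>) v = q (Z None \<omega>) (Z (Some False) \<omega>) (Z (Some True) \<omega>)" for \<omega>
    using Suc.prems by (subst tree_value.simps) (auto simp: Z_def q_def)
  have ZT: "(Z None \<omega>, Z (Some False) \<omega>, Z (Some True) \<omega>) \<in> ?T" for \<omega>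
    using Suc.prems tree_value_le [of "v @ [b]" N "\<lambda>u. \<eta> u \<omega>" for b] by (auto simp: Z_def)
  have event: "{\<omega> \<in> space M. tree_value N (\<lambda>u. \<eta> u \<omega>) v = k} = (\<Union>t\<in>?S. A t)"
  proof (intro equalityI subsetI)
    fix \<omega> assume "\<omega> \<in> {\<omega> \<in> space M. tree_value N (\<lambda>u. \<eta> u \<omega>) v = k}"
    then have "(Z None \<omega>, Z (Some False) \<omega>, Z (Some True) \<omega>) \<in> ?S"
      and "\<omega> \<in> A (Z None \<omega>, Z (Some False) \<omega>, Z (Some True) \<omega>)"
      using ZT [of \<omega>] root_eq [of \<omega>] by (simp_all add: A_def)
    then show "\<omega> \<in> (\<Union>t\<in>?S. A t)" by (rule UN_I)
  next
    fix \<omega> assume "\<omega> \<in> (\<Union>t\<in>?S. A t)"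
    then show "\<omega> \<in> {\<omega> \<in> space M. tree_value N (\<lambda>u. \<eta> u \<omega>) v = k}"
      using root_eq [of \<omega>] by (auto simp: A_def)
  qed
  have "prob {\<omega> \<in> space M. tree_value N (\<lambda>u. \<eta> u \<omega>) v = k} = (\<Sum>t\<in>?S. prob (A t))"
    unfolding event
  proof (rule finite_measure_finite_Union)
    show "finite ?S" by (rule finite_subset [of _ ?T]) auto
    have "A (s, i, j) = (Z None -` {s} \<inter> space M) \<inter> (Z (Some False) -` {i} \<inter> space M)
        \<inter> (Z (Some True) -` {j} \<inter> space M)" for s i j
      unfolding A_def by auto
    moreover have "Z c -` {i} \<inter> space M \<in> events" for c i
      using meas by (rule measurable_sets) simp
    ultimately have "A (s, i, j) \<in> events" for s i j
      by (simp only: sets.Int)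
    then have "A t \<in> events" for t
      by (cases t) simp
    then show "A ` ?S \<subseteq> events" by (intro image_subsetI)
    have At: "t = (Z None \<omega>, Z (Some False) \<omega>, Z (Some True) \<omega>)" if "\<omega> \<in> A t" for t \<omega>
      using that unfolding A_def by (cases t) simp
    show "disjoint_family_on A ?S"
      unfolding disjoint_family_on_def
    proof (intro ballI impI equals0I)
      fix t t' \<omega> assume "t \<noteq> t'" "\<omega> \<in> A t \<inter> A t'"
      then show False using At [of \<omega> t] At [of \<omega> t'] by simp
    qed
  qed
  also have "\<dots> = (\<Sum>t\<in>?T. if case t of (s, i, j) \<Rightarrow> q s i j = k then prob (A t) else 0)"
    by (rule sum.inter_filter) simp
  also have "\<dots> = (\<Sum>(s, i, j)\<in>?T. (1 / 2) * (root_law n i * root_law n j) * of_bool (q s i j = k))"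
  proof (rule sum.cong [OF refl])
    fix t assume "t \<in> ?T"
    then obtain s i j where "t = (s, i, j)" "s \<in> {0, 1}" by (metis SigmaE)
    then show "(if case t of (s, i, j) \<Rightarrow> q s i j = k then prob (A t) else 0) =
        (case t of (s, i, j) \<Rightarrow> (1 / 2) * (root_law n i * root_law n j) * of_bool (q s i j = k))"
      by (simp add: A)
  qed
  also have "\<dots> = (\<Sum>s\<in>{0, 1}. \<Sum>i\<le>2^n. \<Sum>j\<le>2^n. (1 / 2) * (root_law n i * root_law n j) * of_bool (q s i j = k))"
    by (simp only: sum.cartesian_product [symmetric])
  also have "\<dots> = (\<Sum>i\<le>2^n. \<Sum>j\<le>2^n. (1 / 2) * (root_law n i * root_law n j) * of_bool (q 0 i j = k)
      + (1 / 2) * (root_law n i * root_law n j) * of_bool (q 1 i j = k))"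
    unfolding sum.distrib by simp
  also have "\<dots> = root_law (Suc n) k"
    unfolding root_law.simps q_def by (intro sum.cong refl) (simp add: algebra_simps)
  finally show ?case .
qed

lemma prob_root_value_le:
  assumes p: "p = 1 / 2" and N: "1 \<le> N"
  shows "\<P>(\<omega> in M. real (root_value N \<eta> \<omega>) \<le> x) = root_cdf (N - 1) x"
proof -
  define X where "X \<omega> = tree_value N (\<lambda>u. \<eta> u \<omega>) []" for \<omega>
  have sub: "subtree N [] = tree N" by (auto simp: subtree_def tree_def)
  \<comment> \<open>The signs are known to be measurable only on \<open>tree N\<close>, so
    measurability of \<open>X\<close> is obtained from the restricted family.\<close>
  have "(\<lambda>\<omega>. \<lambda>u\<in>tree N. \<eta> u \<omega>) \<in> measurable M (PiM (tree N) (\<lambda>_. count_space UNIV))"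
    using indep by (intro measurable_restrict) (auto simp: indep_vars_def)
  from measurable_compose [OF this measurable_tree_value [of N "[]"]]
  have "(\<lambda>\<omega>. tree_value N (\<lambda>u\<in>tree N. \<eta> u \<omega>) []) \<in> measurable M (count_space UNIV)"
    by (simp add: sub)
  moreover have "tree_value N (\<lambda>u\<in>tree N. \<eta> u \<omega>) [] = X \<omega>" for \<omega>
    unfolding X_def by (intro tree_value_cong) (auto simp: sub)
  ultimately have X: "X \<in> measurable M (count_space UNIV)" by simp
  have "X \<omega> \<le> 2 ^ (N - 1)" for \<omega>
    using tree_value_le [of "[]" N] N by (simp add: X_def)
  then have "{\<omega> \<in> space M. real (X \<omega>) \<le> x} = (\<Union>k\<in>{k. k \<le> 2^(N - 1) \<and> real k \<le> x}. X -` {k} \<inter> space M)"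
    by auto
  also have "prob \<dots> = (\<Sum>k\<in>{k. k \<le> 2^(N - 1) \<and> real k \<le> x}. prob (X -` {k} \<inter> space M))"
    using X by (intro finite_measure_finite_Union) (auto simp: disjoint_family_on_def intro: measurable_sets)
  also have "\<dots> = (\<Sum>k\<in>{k. k \<le> 2^(N - 1) \<and> real k \<le> x}. root_law (N - 1) k)"
  proof (intro sum.cong refl)
    fix k
    have "prob (X -` {k} \<inter> space M) = \<P>(\<omega> in M. tree_value N (\<lambda>u. \<eta> u \<omega>) [] = k)"
      by (intro arg_cong [where f = prob]) (auto simp: X_def)
    also have "\<dots> = root_law (N - 1) k"
      using N by (intro prob_tree_value [OF p]) (auto simp: tree_def)
    finally show "prob (X -` {k} \<inter> space M) = root_law (N - 1) k" .
  qed
  also have "\<dots> = root_cdf (N - 1) x"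
    unfolding root_cdf_def by (intro sum.mono_neutral_cong_left) auto
  finally show ?thesis by (simp add: X_def root_value_def)
qed

end

section \<open>Monotonicity of the convolution\<close>

text \<open>Fubini for a sum of a discrete variable with masses \<open>p k\<close> at
  \<open>r k\<close> and an independent one with density \<open>g\<close>: the integral conditions
  on the continuous summand, the finite sum on the discrete one.\<close>

lemma sum_prob_integral_eq:
  fixes g G :: "real \<Rightarrow> real" and p r :: "'k \<Rightarrow> real"
  assumes A: "finite A" "\<And>k. k \<in> A \<Longrightarrow> 0 \<le> r k"
    and g: "continuous_on UNIV g" and G: "\<And>x. G x = integral {0..x} g"
  shows "((\<lambda>u. g u * (\<Sum>k\<in>A. p k * of_bool (r k \<le> x - u))) has_integral (\<Sum>k\<in>A. p k * G (x - r k))) {0..x}"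
proof -
  have "((\<lambda>u. p k * (g u * of_bool (r k \<le> x - u))) has_integral p k * G (x - r k)) {0..x}" if "k \<in> A" for k
  proof (rule has_integral_mult_right)
    have "(g has_integral G (x - r k)) {0..x - r k}"
      unfolding G by (intro integrable_integral integrable_continuous_real continuous_on_subset [OF g]) auto
    then have "((\<lambda>u. if u \<in> {0..x - r k} then g u else 0) has_integral G (x - r k)) {0..x}"
      by (subst has_integral_restrict) (use A(2)[OF that] in auto)
    then show "((\<lambda>u. g u * of_bool (r k \<le> x - u)) has_integral G (x - r k)) {0..x}"
      by (rule has_integral_eq [rotated]) auto
  qed
  then have "((\<lambda>u. \<Sum>k\<in>A. p k * (g u * of_bool (r k \<le> x - u))) has_integral (\<Sum>k\<in>A. p k * G (x - r k))) {0..x}"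
    by (intro has_integral_sum A)
  moreover have "(\<Sum>k\<in>A. p k * (g u * of_bool (r k \<le> x - u))) = g u * (\<Sum>k\<in>A. p k * of_bool (r k \<le> x - u))" for u
    by (simp only: sum_distrib_left mult.left_commute)
  ultimately show ?thesis by simp
qed

lemma continuous_primitive:
  fixes g G :: "real \<Rightarrow> real"
  assumes g: "continuous_on UNIV g" and G: "\<And>x. G x = integral {0..x} g"
  shows "continuous_on UNIV G"
proof -
  have "continuous_on {-b..b} G" for b
  proof -
    \<comment> \<open>For negative \<open>x\<close> the interval \<open>{0..x}\<close> is empty and
      \<open>G\<close> vanishes, so \<open>G\<close> is the primitive on the half-line composed with
      \<open>max 0\<close>.\<close>
    have "continuous_on {-b..b} (\<lambda>x. integral {0..max 0 x} g)"
    proof (rule continuous_on_compose2 [where g = "\<lambda>x. integral {0..x} g" and t = "{0..max 0 b}"])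
      show "continuous_on {0..max 0 b} (\<lambda>x. integral {0..x} g)"
        by (intro indefinite_integral_continuous_1 integrable_continuous_real continuous_on_subset [OF g]) auto
    qed (auto intro!: continuous_intros)
    moreover have "G x = integral {0..max 0 x} g" for x
      by (cases "x \<ge> 0") (auto simp: G max_def)
    ultimately show ?thesis by simp
  qed
  then have "isCont G x" for x
    by (rule continuous_on_interior [of "{- (\<bar>x\<bar> + 1)..\<bar>x\<bar> + 1}"]) auto
  then show ?thesis by (simp add: continuous_at_imp_continuous_on)
qed

text \<open>A discrete law is compared with \<open>G\<close> in each of the two summands in turn; the identity above
  exchanges the roles of the summands.\<close>

lemma convolution_le:
  fixes g G :: "real \<Rightarrow> real" and p r :: "'k \<Rightarrow> real"
  assumes A: "finite A" "\<And>k. k \<in> A \<Longrightarrow> 0 \<le> r k" "\<And>k. k \<in> A \<Longrightarrow> 0 \<le> p k"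
    and g: "continuous_on UNIV g" "\<And>x. 0 \<le> g x" and G: "\<And>x. G x = integral {0..x} g"
    and F: "\<And>x. F x = (\<Sum>k\<in>A. p k * of_bool (r k \<le> x))" and le: "\<And>x. F x \<le> G x"
  shows "(\<Sum>k\<in>A. p k * F (x - r k)) \<le> integral {0..x} (\<lambda>u. g u * G (x - u))"
proof -
  have "(\<Sum>k\<in>A. p k * F (x - r k)) \<le> (\<Sum>k\<in>A. p k * G (x - r k))"
    by (intro sum_mono mult_left_mono le A)
  also have "\<dots> \<le> integral {0..x} (\<lambda>u. g u * G (x - u))"
  proof (rule has_integral_le [OF sum_prob_integral_eq [OF A(1,2) g(1) G] integrable_integral])
    show "(\<lambda>u. g u * G (x - u)) integrable_on {0..x}"
      by (intro integrable_continuous_real continuous_intros continuous_on_subset [OF g(1)]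
          continuous_on_compose2 [OF continuous_primitive [OF g(1) G]]) auto
  qed (auto simp flip: F intro!: mult_left_mono le g)
  finally show ?thesis .
qed

lemma convolution_ge:
  fixes g G :: "real \<Rightarrow> real" and p r :: "'k \<Rightarrow> real"
  assumes A: "finite A" "\<And>k. k \<in> A \<Longrightarrow> 0 \<le> r k" "\<And>k. k \<in> A \<Longrightarrow> 0 \<le> p k"
    and g: "continuous_on UNIV g" "\<And>x. 0 \<le> g x" and G: "\<And>x. G x = integral {0..x} g"
    and F: "\<And>x. F x = (\<Sum>k\<in>A. p k * of_bool (r k \<le> x))" and le: "\<And>x. G x \<le> F x"
  shows "integral {0..x} (\<lambda>u. g u * G (x - u)) \<le> (\<Sum>k\<in>A. p k * F (x - r k))"
proof -
  have "integral {0..x} (\<lambda>u. g u * G (x - u)) \<le> (\<Sum>k\<in>A. p k * G (x - r k))"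
  proof (rule has_integral_le [OF integrable_integral sum_prob_integral_eq [OF A(1,2) g(1) G]])
    show "(\<lambda>u. g u * G (x - u)) integrable_on {0..x}"
      by (intro integrable_continuous_real continuous_intros continuous_on_subset [OF g(1)]
          continuous_on_compose2 [OF continuous_primitive [OF g(1) G]]) auto
  qed (auto simp flip: F intro!: mult_left_mono le g)
  also have "\<dots> \<le> (\<Sum>k\<in>A. p k * F (x - r k))"
    by (intro sum_mono mult_left_mono le A)
  finally show ?thesis .
qed

text \<open>Write one factor of \<open>(G x)^2\<close> as the integral of \<open>g\<close>, subtract
  the convolution under the integral sign, and substitute \<open>u = x * w\<close>.\<close>

lemma convolution_eq_deficit:
  fixes g G :: "real \<Rightarrow> real"
  assumes g: "continuous_on UNIV g" and G: "\<And>x. G x = integral {0..x} g" and x: "0 < x"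
  shows "((\<lambda>w. x * g (x * w) * (G x - G (x * (1 - w)))) has_integral
     ((G x)\<^sup>2 - integral {0..x} (\<lambda>u. g u * G (x - u)))) {0..1}"
proof -
  have "(\<lambda>u. g u * G (x - u)) integrable_on {0..x}"
    by (intro integrable_continuous_real continuous_intros continuous_on_subset [OF g(1)]
          continuous_on_compose2 [OF continuous_primitive [OF g(1) G]]) auto
  moreover have "(g has_integral G x) {0..x}"
    unfolding G by (intro integrable_integral integrable_continuous_real continuous_on_subset [OF g]) auto
  ultimately have "((\<lambda>u. g u * G x - g u * G (x - u)) has_integral
       (G x * G x - integral {0..x} (\<lambda>u. g u * G (x - u)))) {0..x}"
    by (intro has_integral_diff has_integral_mult_left integrable_integral)
  from has_integral_affinity' [of _ _ 0 x, unfolded cbox_interval, OF this x, of 0] x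
  have "((\<lambda>w. g (x * w) * G x - g (x * w) * G (x - x * w)) has_integral
       (G x * G x - integral {0..x} (\<lambda>u. g u * G (x - u))) / x) {0..1}"
    by (simp add: divide_inverse_commute)
  then have "((\<lambda>w. x * (g (x * w) * G x - g (x * w) * G (x - x * w))) has_integral
       x * ((G x * G x - integral {0..x} (\<lambda>u. g u * G (x - u))) / x)) {0..1}"
    by (rule has_integral_mult_right)
  moreover have "x * (z / x) = z" for z
    using x by simp
  ultimately have "((\<lambda>w. x * (g (x * w) * G x - g (x * w) * G (x - x * w))) has_integral
       G x * G x - integral {0..x} (\<lambda>u. g u * G (x - u))) {0..1}"
    by (simp only:)
  then show ?thesis by (simp add: algebra_simps power2_eq_square)
qed

section \<open>The convolution deficit on the logarithmic scale\<close>

text \<open>The cut at 1 keeps the logarithm nonnegative; with \<open>H 0 = 0\<close> there is no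
  mass below 1, in accordance with root values being at least 1.\<close>

definition log_primitive :: "(real \<Rightarrow> real) \<Rightarrow> real \<Rightarrow> real" where
  "log_primitive H x = H (ln (max 1 x))"

text \<open>By the chain rule this is the density of \<open>log_primitive H\<close> for
  \<open>h = H'\<close>, once \<open>h 0 = 0\<close> makes it vanish below 1.\<close>

definition log_density :: "(real \<Rightarrow> real) \<Rightarrow> real \<Rightarrow> real" where
  "log_density h u = h (ln (max 1 u)) / max 1 u"

text \<open>For independent \<open>X\<close>, \<open>Y\<close> with distribution function \<open>log_primitive H\<close>, this is the probability
  of \<open>max X Y \<le> x < X + Y\<close>.\<close>

definition deficit :: "(real \<Rightarrow> real) \<Rightarrow> (real \<Rightarrow> real) \<Rightarrow> real \<Rightarrow> real" where
  "deficit h H x =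
     (log_primitive H x)\<^sup>2 - integral {0..x} (\<lambda>u. log_density h u * log_primitive H (x - u))"

lemma continuous_log_density:
  assumes "continuous_on {0..} h"
  shows "continuous_on UNIV (log_density h)"
  unfolding log_density_def
  by (intro continuous_intros continuous_on_compose2 [OF assms]) auto

lemma log_density_nonneg:
  assumes "\<And>y. 0 \<le> y \<Longrightarrow> 0 \<le> h y"
  shows "0 \<le> log_density h u"
  unfolding log_density_def by (intro divide_nonneg_nonneg assms) auto

lemma log_primitive_eq_integral:
  fixes h H :: "real \<Rightarrow> real"
  assumes h: "continuous_on {0..} h" "h 0 = 0"
    and H: "H 0 = 0" "\<And>y. 0 \<le> y \<Longrightarrow> (H has_real_derivative h y) (at y within {0..})"
  shows "log_primitive H x = integral {0..x} (log_density h)"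
proof (cases "x \<le> 1")
  case True
  then have "integral {0..x} (log_density h) = integral {0..x} (\<lambda>_. 0)"
    by (intro integral_cong) (simp add: log_density_def max_absorb1 h)
  then show ?thesis using True by (simp add: log_primitive_def max_def H)
next
  case False
  have c: "log_density h integrable_on {a..b}" for a b
    by (intro integrable_continuous_real continuous_on_subset [OF continuous_log_density [OF h(1)]]) auto
  have "(log_density h has_integral log_primitive H x - log_primitive H 1) {1..x}"
  proof (rule fundamental_theorem_of_calculus)
    fix u assume u: "u \<in> {1..x}"
    have "((H \<circ> ln) has_real_derivative h (ln u) * (1 / u)) (at u within {1..x})"
    proof (rule DERIV_image_chain)
      show "(H has_real_derivative h (ln u)) (at (ln u) within ln ` {1..x})"
        using u by (intro DERIV_subset [OF H(2)]) auto
      show "(ln has_real_derivative 1 / u) (at u within {1..x})"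
        using u by (auto intro!: derivative_eq_intros)
    qed
    then have "((\<lambda>u. H (ln u)) has_vector_derivative log_density h u) (at u within {1..x})"
      using u by (simp add: o_def log_density_def has_real_derivative_iff_has_vector_derivative)
    then show "(log_primitive H has_vector_derivative log_density h u) (at u within {1..x})"
      by (rule has_vector_derivative_transform [rotated 2]) (use u in \<open>auto simp: log_primitive_def\<close>)
  qed (use False in auto)
  then have "integral {1..x} (log_density h) = log_primitive H x"
    using H by (simp add: integral_unique log_primitive_def)
  moreover have "integral {0..1} (log_density h) = integral {0..1} (\<lambda>_::real. 0)"
    by (intro integral_cong) (auto simp: log_density_def h max_def)
  moreover have "integral {0..1} (log_density h) + integral {1..x} (log_density h)
      = integral {0..x} (log_density h)"
    using False by (intro Henstock_Kurzweil_Integration.integral_combine c) auto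
  ultimately show ?thesis by simp
qed

lemma has_integral_deficit:
  fixes h H :: "real \<Rightarrow> real"
  assumes "continuous_on {0..} h" "h 0 = 0"
    and "H 0 = 0" "\<And>y. 0 \<le> y \<Longrightarrow> (H has_real_derivative h y) (at y within {0..})"
    and "0 < x"
  shows "((\<lambda>w. x * log_density h (x * w) * (log_primitive H x - log_primitive H (x * (1 - w))))
     has_integral deficit h H x) {0<..<1}"
  \<comment> \<open>The open interval leaves out the endpoints, where the logarithms of
    \<open>w\<close> and \<open>1 - w\<close> in the later estimates are singular.\<close>
  unfolding deficit_def has_integral_Icc_iff_Ioo [symmetric]
  by (intro convolution_eq_deficit continuous_log_density log_primitive_eq_integral assms)

text \<open>The factors \<open>w powr -\<mu>\<close> and \<open>(1 - w) powr -\<mu>\<close> bound the variation of a density that decays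
  at most like \<open>exp (- \<mu> y)\<close>.\<close>

definition dilog_kernel :: "real \<Rightarrow> real \<Rightarrow> real" where
  "dilog_kernel \<mu> w = w powr (-1-\<mu>) * (1 - w) powr (-\<mu>) * (- ln (1 - w))"

text \<open>In the deficit integral the density is evaluated at \<open>y + ln w\<close>, which by
  the decay bound costs a factor \<open>w powr (-\<mu>)\<close>. The increment of \<open>H\<close>
  runs over a length of at most \<open>L = - ln (1 - w)\<close>, so by the mean value theorem it is
  at most \<open>h y * L\<close> times
  \<open>exp (\<mu> * L) = (1 - w) powr (-\<mu>)\<close>.\<close>

lemma deficit_le:
  fixes h H :: "real \<Rightarrow> real"
  assumes h: "continuous_on {0..} h" "h 0 = 0" "\<And>y. 0 \<le> y \<Longrightarrow> 0 \<le> h y"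
    and H: "H 0 = 0" "\<And>y. 0 \<le> y \<Longrightarrow> (H has_real_derivative h y) (at y within {0..})"
    and y: "0 \<le> y" and \<mu>: "0 \<le> \<mu>" and decay: "\<And>z. 0 \<le> z \<Longrightarrow> z \<le> y \<Longrightarrow> h z \<le> h y * exp (\<mu> * (y - z))"
    and int: "dilog_kernel \<mu> integrable_on {0<..<1}"
  shows "deficit h H (exp y) \<le> (h y)\<^sup>2 * integral {0<..<1} (dilog_kernel \<mu>)"
proof -
  have "deficit h H (exp y) \<le> integral {0<..<1} (\<lambda>w. (h y)\<^sup>2 * dilog_kernel \<mu> w)"
  proof (rule has_integral_le [OF has_integral_deficit integrable_integral])
    fix w :: real assume w: "w \<in> {0<..<1}"
    define L where "L = - ln (1 - w)"
    have L: "0 \<le> L" using w by (simp add: L_def)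
    have 1: "exp y * log_density h (exp y * w) \<le> h y * w powr (-1-\<mu>)"
    proof (cases "exp y * w \<le> 1")
      case True
      then show ?thesis using h y w by (simp add: log_density_def max_def)
    next
      case False
      then have "0 \<le> ln (exp y * w)" using w by simp
      then have p: "0 \<le> y + ln w" using w by (simp add: ln_mult)
      have "exp y * log_density h (exp y * w) = h (y + ln w) / w"
        using False w by (simp add: log_density_def ln_mult)
      also have "\<dots> \<le> h y * exp (\<mu> * (y - (y + ln w))) / w"
        using w p by (intro divide_right_mono decay) auto
      also have "\<dots> = h y * w powr (-1-\<mu>)"
        using w by (simp add: powr_def exp_diff exp_minus field_simps flip: exp_add)
      finally show ?thesis .
    qed
    have 2: "log_primitive H (exp y) - log_primitive H (exp y * (1 - w)) \<le> h y * ((1 - w) powr (-\<mu>) * L)"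
    proof -
      \<comment> \<open>The logarithmic coordinate of \<open>exp y * (1 - w)\<close>, cut off at 0
        as in \<open>log_primitive\<close>.\<close>
      define z where "z = max 0 (y - L)"
      have z: "0 \<le> z" "z \<le> y" "y - z \<le> L" using y L by (auto simp: z_def)
      have "ln (max 1 (exp y * (1 - w))) = max 0 (ln (exp y * (1 - w)))"
        using w by (auto simp: max_def)
      then have "log_primitive H (exp y * (1 - w)) = H z"
        using w by (simp add: log_primitive_def z_def L_def ln_mult)
      moreover have "log_primitive H (exp y) = H y" using y by (simp add: log_primitive_def)
      moreover have "H y - H z \<le> h y * (exp (\<mu> * L) * L)"
      proof (cases "z = y")
        case True
        then show ?thesis using h(3) [OF y] L by simp
      next
        case False
        then have "z < y" using z by simp
        moreover have "(H has_derivative (\<lambda>v. h t * v)) (at t within {z..y})" if "z \<le> t" "t \<le> y" for t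
        proof -
          have "(H has_real_derivative h t) (at t within {z..y})"
            by (rule DERIV_subset [OF H(2)]) (use that z in auto)
          then show ?thesis by (rule has_field_derivative_imp_has_derivative)
        qed
        ultimately obtain \<xi> where \<xi>: "z < \<xi>" "\<xi> < y" "H y - H z = h \<xi> * (y - z)"
          using mvt_simple [of z y H "\<lambda>t v. h t * v"] by (metis greaterThanLessThan_iff)
        have "h \<xi> \<le> h y * exp (\<mu> * (y - \<xi>))" using \<xi> z by (intro decay) auto
        also have "\<dots> \<le> h y * exp (\<mu> * L)"
          using \<xi> z \<mu> h(3) [OF y] by (intro mult_left_mono) (auto intro!: mult_left_mono)
        finally have "(y - z) * h \<xi> \<le> L * (h y * exp (\<mu> * L))"
          using z L \<xi> h(3) by (intro mult_mono) auto
        then show ?thesis using \<xi>(3) by (simp add: mult_ac)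
      qed
      moreover have "(1 - w) powr (-\<mu>) = exp (\<mu> * L)" using w by (simp add: powr_def L_def)
      ultimately show ?thesis by simp
    qed
    show "exp y * log_density h (exp y * w) * (log_primitive H (exp y) - log_primitive H (exp y * (1 - w)))
        \<le> (h y)\<^sup>2 * dilog_kernel \<mu> w"
    proof -
      have "exp y * log_density h (exp y * w) * (log_primitive H (exp y) - log_primitive H (exp y * (1 - w)))
        \<le> exp y * log_density h (exp y * w) * (h y * ((1 - w) powr (-\<mu>) * L))"
        by (intro mult_left_mono 2) (auto simp: log_density_def intro!: h mult_nonneg_nonneg divide_nonneg_nonneg)
      also have "\<dots> \<le> (h y * w powr (-1-\<mu>)) * (h y * ((1 - w) powr (-\<mu>) * L))"
        using L h(3) [OF y] by (intro mult_right_mono 1) auto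
      also have "\<dots> = (h y)\<^sup>2 * dilog_kernel \<mu> w"
        by (simp add: dilog_kernel_def L_def power2_eq_square)
      finally show ?thesis .
    qed
  qed (use assms in \<open>auto intro: integrable_on_mult_right\<close>)
  then show ?thesis by simp
qed

text \<open>The integrand is nonnegative, so \<open>w\<close> may be confined to
  \<open>{\<delta>..1-\<delta>}\<close>. There \<open>ln w\<close> and \<open>ln (1 - w)\<close> are
  at least \<open>ln \<delta>\<close>, and \<open>y \<ge> - ln \<delta>\<close> keeps both points
  above the cut at 1.\<close>

lemma deficit_square_ge:
  fixes b y \<delta> :: real
  assumes b: "0 < b" and \<delta>: "0 < \<delta>" "\<delta> < 1" and y: "- ln \<delta> \<le> y"
  shows "4 * (y + ln \<delta>)\<^sup>2 / b\<^sup>2 * integral {\<delta>..1-\<delta>} (\<lambda>w. - ln (1 - w) / w)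
     \<le> deficit (\<lambda>y. 2 * y / b) (\<lambda>y. y\<^sup>2 / b) (exp y)"
proof -
  let ?h = "\<lambda>y. 2 * y / b" and ?H = "\<lambda>y. y\<^sup>2 / b"
  let ?I = "\<lambda>w. exp y * log_density ?h (exp y * w) * (log_primitive ?H (exp y) - log_primitive ?H (exp y * (1 - w)))"
  have y0: "0 \<le> y" using y \<delta> ln_less_zero [of \<delta>] by linarith
  have D: "(?I has_integral deficit ?h ?H (exp y)) {0<..<1}"
    using b by (intro has_integral_deficit) (auto intro!: continuous_intros derivative_eq_intros)
  have I0: "0 \<le> ?I w" if w: "w \<in> {0<..<1}" for w
  proof -
    have "log_primitive ?H (exp y * (1 - w)) \<le> log_primitive ?H (exp y)"
      unfolding log_primitive_def using w b y0 by (intro divide_right_mono power_mono) (auto simp: max_def ln_mult)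
    then show ?thesis using b
      by (intro mult_nonneg_nonneg) (auto simp: log_density_def)
  qed
  have I: "4 * (y + ln \<delta>)\<^sup>2 / b\<^sup>2 * (- ln (1 - w) / w) \<le> ?I w" if w: "w \<in> {\<delta>..1-\<delta>}" for w
  proof -
    have w': "ln \<delta> < 0" "ln \<delta> \<le> ln w" "ln \<delta> \<le> ln (1 - w)" "0 < w" "w < 1" "ln (1 - w) \<le> 0" using w \<delta> by auto
    have "0 \<le> ln (exp y * w)" "0 \<le> ln (exp y * (1 - w))"
      using w' y by (auto simp: ln_mult)
    then have m: "max 1 (exp y * w) = exp y * w" "max 1 (exp y * (1 - w)) = exp y * (1 - w)"
      using w' by (auto simp: max_def)
    have "exp y * log_density ?h (exp y * w) = 2 * (y + ln w) / (b * w)"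
      unfolding log_density_def m using w' b by (simp add: ln_mult)
    then have "?I w = 2 * (y + ln w) / (b * w) * ((y\<^sup>2 - (y + ln (1 - w))\<^sup>2) / b)"
      using w' b y0 by (simp add: log_primitive_def m ln_mult diff_divide_distrib)
    also have "\<dots> \<ge> 2 * (y + ln \<delta>) / (b * w) * (2 * (y + ln \<delta>) * (- ln (1 - w)) / b)"
    proof (intro mult_mono divide_right_mono)
      \<comment> \<open>With \<open>l = ln (1 - w)\<close> the difference of squares is
        \<open>(2 * y + l) * (- l)\<close>, and \<open>l\<close> is at least
        \<open>2 * ln \<delta>\<close>.\<close>
      have "2 * (y + ln \<delta>) * (- ln (1 - w)) \<le> (2 * y + ln (1 - w)) * (- ln (1 - w))"
        using w' y y0 by (intro mult_right_mono) auto
      then show "2 * (y + ln \<delta>) * (- ln (1 - w)) \<le> y\<^sup>2 - (y + ln (1 - w))\<^sup>2"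
        by (simp add: power2_eq_square algebra_simps)
    qed (use w' y y0 b in \<open>auto intro!: divide_nonneg_nonneg mult_nonneg_nonneg divide_nonpos_nonneg mult_nonneg_nonpos\<close>)
    also have "2 * (y + ln \<delta>) / (b * w) * (2 * (y + ln \<delta>) * (- ln (1 - w)) / b)
        = 4 * (y + ln \<delta>)\<^sup>2 / b\<^sup>2 * (- ln (1 - w) / w)"
    proof -
      have "2 * z / (b * w) * (2 * z * l / b) = 4 * z\<^sup>2 / b\<^sup>2 * (l / w)" for z l
        by (simp add: power2_eq_square mult_ac)
      then show ?thesis .
    qed
    finally show ?thesis .
  qed
  have "integral {\<delta>..1-\<delta>} (\<lambda>w. 4 * (y + ln \<delta>)\<^sup>2 / b\<^sup>2 * (- ln (1 - w) / w)) \<le> integral {\<delta>..1-\<delta>} ?I"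
  proof (rule integral_le)
    show "(\<lambda>w. 4 * (y + ln \<delta>)\<^sup>2 / b\<^sup>2 * (- ln (1 - w) / w)) integrable_on {\<delta>..1-\<delta>}"
      using \<delta> by (intro integrable_continuous_real continuous_intros) auto
    show "?I integrable_on {\<delta>..1-\<delta>}"
      using D \<delta> by (intro integrable_on_subinterval [of _ "{0<..<1}"]) auto
  qed (use I in auto)
  also have "\<dots> \<le> integral {0<..<1} ?I"
    using \<delta> D I0 by (intro integral_subset_le integrable_on_subinterval [of _ "{0<..<1}"]) auto
  also have "\<dots> = deficit ?h ?H (exp y)" using D by (rule integral_unique)
  finally show ?thesis by (simp only: Henstock_Kurzweil_Integration.integral_mult_right)
qed

section \<open>The dilogarithm integral and its perturbations\<close>

text \<open>Apply \<open>ln z \<le> z - 1\<close> at \<open>z = 1 / sqrt (1 - w)\<close>. The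
  exponent -1/2 leaves room for the further factor \<open>(1 - w) powr (-\<mu>)\<close> to stay
  integrable.\<close>

lemma minus_ln_one_minus_le:
  fixes w :: real
  assumes w: "0 < w" "w < 1"
  shows "- ln (1 - w) \<le> 2 * w * (1 - w) powr (-1/2)"
proof -
  define s where "s = sqrt (1 - w)"
  have s: "0 < s" "s < 1" "s * s = 1 - w" using w by (auto simp: s_def real_sqrt_lt_1_iff)
  have "- ln (1 - w) = 2 * ln (1 / s)"
    using s by (simp add: ln_div ln_mult flip: s(3))
  also have "\<dots> \<le> 2 * (1 / s - 1)"
    using s ln_le_minus_one [of "1 / s"] by simp
  also have "\<dots> = 2 * (1 - s) / s"
    using s by (simp add: field_simps)
  also have "\<dots> \<le> 2 * w / s"
    using s mult_left_le [of s s] by (intro divide_right_mono) auto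
  also have "\<dots> = 2 * w * (1 - w) powr (-1/2)"
    using w by (simp add: s_def powr_minus_divide powr_half_sqrt)
  finally show ?thesis .
qed

lemma dilog_kernel_nonneg: "0 \<le> w \<Longrightarrow> w < 1 \<Longrightarrow> 0 \<le> dilog_kernel \<mu> w"
  by (auto simp: dilog_kernel_def mult_nonneg_nonpos)

text \<open>A majorant uniform in \<open>\<mu>\<close>, for dominated convergence. It is twice the
  Beta integrand with parameters 3/4 and 1/4.\<close>

lemma dilog_kernel_le:
  assumes "0 \<le> \<mu>" "\<mu> \<le> 1 / 4" "0 < w" "w < 1"
  shows "dilog_kernel \<mu> w \<le> 2 * (w powr (-1/4) * (1 - w) powr (-3/4))"
proof -
  have "dilog_kernel \<mu> w \<le> w powr (-1-\<mu>) * (1 - w) powr (-\<mu>) * (2 * w * (1 - w) powr (-1/2))"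
    unfolding dilog_kernel_def using assms by (intro mult_left_mono minus_ln_one_minus_le) auto
  also have "\<dots> = 2 * ((w powr (-1-\<mu>) * w powr 1) * ((1 - w) powr (-\<mu>) * (1 - w) powr (-1/2)))"
    using assms by simp
  also have "\<dots> = 2 * (w powr (-\<mu>) * (1 - w) powr (-\<mu> - 1/2))"
    by (simp only: powr_add [symmetric]) simp
  also have "\<dots> \<le> 2 * (w powr (-1/4) * (1 - w) powr (-3/4))"
    using assms by (intro mult_left_mono mult_mono powr_mono') auto
  finally show ?thesis .
qed

lemma dilog_majorant: "(\<lambda>w. 2 * (w powr (-1/4) * (1 - w) powr (-3/4))) integrable_on {0<..<1::real}"
  using has_integral_Beta_real [of "3/4" "1/4"]
  by (intro integrable_on_mult_right) (auto simp: has_integral_Icc_iff_Ioo)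

lemma dilog_kernel_integrable:
  assumes "0 \<le> \<mu>" "\<mu> \<le> 1 / 4"
  shows "dilog_kernel \<mu> integrable_on {0<..<1}"
proof (rule measurable_bounded_by_integrable_imp_integrable_real [OF _ dilog_majorant])
  show "dilog_kernel \<mu> \<in> borel_measurable (lebesgue_on {0<..<1})"
    unfolding dilog_kernel_def
    by (intro continuous_imp_measurable_on_sets_lebesgue continuous_intros) auto
qed (use assms dilog_kernel_le dilog_kernel_nonneg in auto)

text \<open>At \<open>\<mu> = 0\<close> the kernel is \<open>- ln (1 - w) / w\<close>, the sum of
  \<open>w^n / (n + 1)\<close>. Integrating term by term gives the sum of the inverse squares, and
  this is where \<open>pi\<close> enters.\<close>

lemma has_integral_dilog_kernel_0: "(dilog_kernel 0 has_integral pi\<^sup>2 / 6) {0<..<1}"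
proof -
  define f where "f k w = (\<Sum>n<k. w ^ n / real (n + 1))" for k and w :: real
  have sums: "(\<lambda>n. w ^ n / real (n + 1)) sums dilog_kernel 0 w" if w: "w \<in> {0<..<1}" for w
  proof -
    have "(\<lambda>n. - ((- (- w)) ^ n) / real n) sums ln (1 + (- w))"
      using w by (intro ln_series') auto
    then have "(\<lambda>n. - (w ^ n) / real n) sums ln (1 - w)" by simp
    then have "(\<lambda>n. - (w ^ Suc n) / real (Suc n)) sums ln (1 - w)"
      by (subst sums_Suc_iff) simp
    then have "(\<lambda>n. - (1 / w) * (- (w ^ Suc n) / real (Suc n))) sums (- (1 / w) * ln (1 - w))"
      by (rule sums_mult)
    moreover have "- (1 / w) * (- (w ^ Suc n) / real (Suc n)) = w ^ n / real (n + 1)" for n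
      using w by simp
    moreover have "- (1 / w) * ln (1 - w) = dilog_kernel 0 w"
      using w by (simp add: dilog_kernel_def powr_minus_divide)
    ultimately show ?thesis by simp
  qed
  show ?thesis
  proof (rule has_integral_dominated_convergence [OF _ dilog_majorant])
    show "(f k has_integral (\<Sum>n<k. 1 / (real n + 1)\<^sup>2)) {0<..<1}" for k
      unfolding f_def
    proof (intro has_integral_sum)
      fix n
      have "((\<lambda>w::real. w ^ n / real (n + 1)) has_integral
         (1 ^ Suc n / (real (n + 1))\<^sup>2 - 0 ^ Suc n / (real (n + 1))\<^sup>2)) {0..1}"
      proof (rule fundamental_theorem_of_calculus)
        fix w :: real
        have "((\<lambda>w. w ^ Suc n / (real (n + 1))\<^sup>2) has_real_derivative
            real (Suc n) * w ^ (Suc n - Suc 0) / (real (n + 1))\<^sup>2) (at w within {0..1})"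
          by (intro DERIV_cdivide DERIV_pow)
        moreover have "real (Suc n) * w ^ (Suc n - Suc 0) / (real (n + 1))\<^sup>2 = w ^ n / real (n + 1)"
          by (simp add: power2_eq_square del: of_nat_Suc)
        ultimately show "((\<lambda>w. w ^ Suc n / (real (n + 1))\<^sup>2) has_vector_derivative w ^ n / real (n + 1)) (at w within {0..1})"
          by (simp only: has_real_derivative_iff_has_vector_derivative)
      qed simp
      then show "((\<lambda>w::real. w ^ n / real (n + 1)) has_integral 1 / (real n + 1)\<^sup>2) {0<..<1}"
        by (simp add: has_integral_Icc_iff_Ioo add.commute)
    qed simp
    show "\<forall>w\<in>{0<..<1}. norm (f k w) \<le> 2 * (w powr (-1/4) * (1 - w) powr (-3/4))" for k
    proof
      fix w :: real assume w: "w \<in> {0<..<1}"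
      have "f k w \<le> dilog_kernel 0 w"
        unfolding f_def using w by (subst sums_unique [OF sums [OF w]])
          (intro sum_le_suminf sums_summable [OF sums [OF w]], auto)
      moreover have "0 \<le> f k w" using w by (auto simp: f_def intro!: sum_nonneg)
      ultimately show "norm (f k w) \<le> 2 * (w powr (-1/4) * (1 - w) powr (-3/4))"
        using dilog_kernel_le [of 0 w] w by auto
    qed
    show "\<forall>w\<in>{0<..<1}. (\<lambda>k. f k w) \<longlonglongrightarrow> dilog_kernel 0 w"
      using sums by (auto simp: f_def sums_def)
    show "(\<lambda>k. \<Sum>n<k. 1 / (real n + 1)\<^sup>2) \<longlonglongrightarrow> pi\<^sup>2 / 6"
      using inverse_squares_sums by (simp add: sums_def add.commute)
  qed
qed

lemma integral_dilog_kernel_tendsto: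
  assumes "\<mu> \<longlonglongrightarrow> 0" "\<And>n. 0 \<le> \<mu> n"
  shows "(\<lambda>n. integral {0<..<1} (dilog_kernel (\<mu> n))) \<longlonglongrightarrow> pi\<^sup>2 / 6"
proof -
  \<comment> \<open>Capping \<open>\<mu> n\<close> at 1/4 makes the majorant valid for every
    \<open>n\<close>; the cap is eventually inactive.\<close>
  have "(\<lambda>n. integral {0<..<1} (dilog_kernel (min (\<mu> n) (1 / 4)))) \<longlonglongrightarrow> integral {0<..<1} (dilog_kernel 0)"
  proof (rule dominated_convergence(2) [OF _ dilog_majorant])
    show "dilog_kernel (min (\<mu> n) (1 / 4)) integrable_on {0<..<1}" for n
      using assms by (intro dilog_kernel_integrable) auto
    show "norm (dilog_kernel (min (\<mu> n) (1 / 4)) w) \<le> 2 * (w powr (-1/4) * (1 - w) powr (-3/4))"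
      if "w \<in> {0<..<1}" for n w
      using that assms dilog_kernel_le [of "min (\<mu> n) (1 / 4)" w] dilog_kernel_nonneg [of w "min (\<mu> n) (1 / 4)"] by auto
    have "(\<lambda>n. min (\<mu> n) (1 / 4)) \<longlonglongrightarrow> min 0 (1 / 4)"
      by (intro tendsto_intros assms)
    then have m: "(\<lambda>n. min (\<mu> n) (1 / 4)) \<longlonglongrightarrow> 0" by simp
    show "(\<lambda>n. dilog_kernel (min (\<mu> n) (1 / 4)) w) \<longlonglongrightarrow> dilog_kernel 0 w" if "w \<in> {0<..<1}" for w
      unfolding dilog_kernel_def using that by (intro tendsto_intros m) auto
  qed
  moreover have "\<forall>\<^sub>F n in sequentially. \<mu> n < 1 / 4"
    by (rule order_tendstoD [OF assms(1)]) simp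
  then have "\<forall>\<^sub>F n in sequentially. integral {0<..<1} (dilog_kernel (min (\<mu> n) (1 / 4)))
      = integral {0<..<1} (dilog_kernel (\<mu> n))"
    by eventually_elim (simp add: min_def)
  ultimately show ?thesis
    using has_integral_dilog_kernel_0 by (simp add: integral_unique tendsto_cong)
qed

text \<open>Prepares the interval for \<open>deficit_square_ge\<close>: the primitive of the kernel
  is continuous on \<open>[0, 1]\<close>, so cutting off both ends costs arbitrarily little. The
  cuts \<open>1 / (n + 2)\<close> are at most 1/2, which keeps the interval nonempty.\<close>

lemma dilog_truncation:
  assumes "J < pi\<^sup>2 / 6"
  obtains \<delta> :: real where "0 < \<delta>" "\<delta> < 1" "J < integral {\<delta>..1-\<delta>} (\<lambda>w. - ln (1 - w) / w)"
proof -
  let ?f = "dilog_kernel 0"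
  have int: "?f integrable_on {0..1}"
    unfolding integrable_on_Icc_iff_Ioo
    by (rule has_integral_integrable [OF has_integral_dilog_kernel_0])
  have I01: "integral {0..1} ?f = pi\<^sup>2 / 6"
    using has_integral_dilog_kernel_0 by (intro integral_unique) (simp add: has_integral_Icc_iff_Ioo)
  define P where "P x = integral {0..x} ?f" for x
  have P: "continuous_on {0..1} P"
    unfolding P_def by (rule indefinite_integral_continuous_1 [OF int])
  have lim: "(\<lambda>n. inverse (real (Suc (Suc n)))) \<longlonglongrightarrow> 0"
    by (intro LIMSEQ_Suc LIMSEQ_inverse_real_of_nat)
  have in01: "inverse (real (Suc (Suc n))) \<in> {0..1}" "1 - inverse (real (Suc (Suc n))) \<in> {0..1}" for n
    by (auto simp: field_simps)
  have "(\<lambda>n. P (1 - inverse (real (Suc (Suc n)))) - P (inverse (real (Suc (Suc n))))) \<longlonglongrightarrow> P (1 - 0) - P 0"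
    by (intro tendsto_diff continuous_on_tendsto_compose [OF P] tendsto_const lim always_eventually allI in01) auto
  then have "(\<lambda>n. P (1 - inverse (real (Suc (Suc n)))) - P (inverse (real (Suc (Suc n))))) \<longlonglongrightarrow> pi\<^sup>2 / 6"
    by (simp add: P_def I01)
  from order_tendstoD(1) [OF this assms]
  obtain n where n: "J < P (1 - inverse (real (Suc (Suc n)))) - P (inverse (real (Suc (Suc n))))"
    by (auto simp: eventually_sequentially)
  define \<delta> where "\<delta> = inverse (real (Suc (Suc n)))"
  have \<delta>: "0 < \<delta>" "\<delta> \<le> 1 / 2" by (auto simp: \<delta>_def field_simps)
  have "P \<delta> + integral {\<delta>..1-\<delta>} ?f = P (1 - \<delta>)"
    unfolding P_def using \<delta>
    by (intro Henstock_Kurzweil_Integration.integral_combine integrable_on_subinterval [OF int]) auto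
  moreover have "integral {\<delta>..1-\<delta>} ?f = integral {\<delta>..1-\<delta>} (\<lambda>w. - ln (1 - w) / w)"
    using \<delta> by (intro Henstock_Kurzweil_Integration.integral_cong) (simp add: dilog_kernel_def powr_minus_divide)
  ultimately show ?thesis using n \<delta> by (intro that [of \<delta>]) (auto simp: \<delta>_def)
qed

section \<open>Lower bound for the distribution function\<close>

text \<open>Comparison principle from below: \<open>z - z^2/2\<close> increases up to 1 and the
  convolution is monotone. For \<open>G = log_primitive H\<close> the right side of the recursion
  collapses to \<open>G - deficit/2\<close>.\<close>

lemma root_cdf_Suc_ge:
  fixes h H :: "real \<Rightarrow> real"
  assumes h: "continuous_on {0..} h" "h 0 = 0" "\<And>y. 0 \<le> y \<Longrightarrow> 0 \<le> h y"
    and H: "H 0 = 0" "\<And>y. 0 \<le> y \<Longrightarrow> (H has_real_derivative h y) (at y within {0..})"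
    and le: "\<And>x. log_primitive H x \<le> root_cdf n x"
  shows "log_primitive H x - deficit h H x / 2 \<le> root_cdf (Suc n) x"
proof -
  let ?F = "root_cdf n x" and ?G = "log_primitive H x"
  have "integral {0..x} (\<lambda>u. log_density h u * log_primitive H (x - u))
      \<le> (\<Sum>k\<le>2^n. root_law n k * root_cdf n (x - real k))"
    by (rule convolution_ge [OF _ _ _ continuous_log_density [OF h(1)] log_density_nonneg [OF h(3)]
        log_primitive_eq_integral [OF h(1,2) H] root_cdf_def le]) (auto simp: root_law_nonneg)
  moreover have "?G - ?G\<^sup>2 / 2 \<le> ?F - ?F\<^sup>2 / 2"
  proof -
    have "0 \<le> (?F - ?G) * (2 - ?F - ?G)"
      using le [of x] root_cdf_le_1 [of n x] by (intro mult_nonneg_nonneg) auto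
    then show ?thesis by (simp add: power2_eq_square algebra_simps)
  qed
  ultimately show ?thesis
    unfolding root_cdf_Suc deficit_def by (simp add: field_simps)
qed

section \<open>The bent quadratic profile\<close>

text \<open>The density \<open>2 * z / a\<close> of the quadratic profile, continued from
  \<open>b\<close> on by an exponential tail of rate \<open>\<theta>\<close>: for positive
  parameters the minimum switches at \<open>z = b\<close>. Such a tail decays slowly enough for
  \<open>deficit_le\<close>.\<close>

definition profile_density :: "real \<Rightarrow> real \<Rightarrow> real \<Rightarrow> real \<Rightarrow> real" where
  "profile_density a b \<theta> z = 2 / a * min z (b * exp (- \<theta> * (z - b)))"

definition profile :: "real \<Rightarrow> real \<Rightarrow> real \<Rightarrow> real \<Rightarrow> real" where
  "profile a b \<theta> z = integral {0..z} (profile_density a b \<theta>)"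

context
  fixes a b \<theta> :: real
  assumes pos: "0 < a" "0 < b" "0 < \<theta>"
begin

lemma continuous_profile_density: "continuous_on S (profile_density a b \<theta>)"
  unfolding profile_density_def by (intro continuous_intros)

lemma profile_density_integrable: "profile_density a b \<theta> integrable_on {u..v}"
  by (intro integrable_continuous_real continuous_profile_density)

lemma profile_density_0: "profile_density a b \<theta> 0 = 0"
  using pos by (simp add: profile_density_def min_def)

lemma profile_density_nonneg: "0 \<le> z \<Longrightarrow> 0 \<le> profile_density a b \<theta> z"
  using pos by (simp add: profile_density_def)

lemma profile_density_le: "profile_density a b \<theta> z \<le> 2 * z / a"
  using pos by (simp add: profile_density_def field_simps)

text \<open>Supplies the decay hypothesis of \<open>deficit_le\<close>: the linear branch increases,
  and the exponential branch satisfies the bound with equality.\<close>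

lemma profile_density_decay:
  assumes "0 \<le> z" "z \<le> x"
  shows "profile_density a b \<theta> z \<le> profile_density a b \<theta> x * exp (\<theta> * (x - z))"
proof -
  have "z * 1 \<le> x * exp (\<theta> * (x - z))" using assms pos by (intro mult_mono) auto
  moreover have "b * exp (- \<theta> * (z - b)) = (b * exp (- \<theta> * (x - b))) * exp (\<theta> * (x - z))"
    by (simp add: algebra_simps flip: exp_add)
  ultimately have "min z (b * exp (- \<theta> * (z - b))) \<le> min x (b * exp (- \<theta> * (x - b))) * exp (\<theta> * (x - z))"
    by (auto simp: min_def)
  then show ?thesis unfolding profile_density_def mult.assoc using pos by (intro mult_left_mono) auto
qed

text \<open>The ratio of the density to \<open>z\<close> never increases, so the graph lies above
  its chords from the origin. This keeps the later estimate of the profile's decrease in time sharp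
  on the quadratic part.\<close>

lemma profile_density_star:
  assumes "0 \<le> z" "z \<le> x" "0 < x"
  shows "z * (profile_density a b \<theta> x / x) \<le> profile_density a b \<theta> z"
proof -
  define e where "e t = b * exp (- \<theta> * (t - b))" for t
  have e: "0 < e x" "e x \<le> e z"
    using pos assms by (auto simp: e_def intro!: mult_left_mono)
  have "z / x * min x (e x) \<le> z"
  proof -
    have "z / x * min x (e x) \<le> z / x * x" using assms by (intro mult_left_mono) auto
    then show ?thesis using assms by simp
  qed
  moreover have "z / x * min x (e x) \<le> 1 * e x"
    using assms e by (intro mult_mono) auto
  ultimately have "z / x * min x (e x) \<le> min z (e z)" using e by simp
  then have "2 / a * (z / x * min x (e x)) \<le> 2 / a * min z (e z)"
    using pos by (intro mult_left_mono) auto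
  then show ?thesis by (simp add: profile_density_def e_def mult_ac)
qed

lemma profile_0: "profile a b \<theta> 0 = 0"
  by (simp add: profile_def)

lemma profile_deriv:
  assumes "0 \<le> z"
  shows "(profile a b \<theta> has_real_derivative profile_density a b \<theta> z) (at z within {0..})"
proof -
  \<comment> \<open>The right end \<open>z + 1\<close> leaves a neighbourhood of \<open>z\<close> in
    \<open>{0..}\<close> inside the interval, so both one-sided notions of derivative agree.\<close>
  have "(profile a b \<theta> has_real_derivative profile_density a b \<theta> z) (at z within {0..z+1})"
    unfolding profile_def [abs_def]
    by (rule integral_has_real_derivative [OF continuous_profile_density]) (use assms in auto)
  moreover have "at z within {0..z+1} = at z within {0..}"
    by (rule at_within_nhd [of z "{..<z+1}"]) auto
  ultimately show ?thesis by simp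
qed

lemma profile_diff:
  assumes "0 \<le> x'" "x' \<le> x"
  shows "profile a b \<theta> x - profile a b \<theta> x' = integral {x'..x} (profile_density a b \<theta>)"
  unfolding profile_def
  using Henstock_Kurzweil_Integration.integral_combine [OF assms profile_density_integrable] by linarith

text \<open>Integrates the chord bound; it will measure how far the rescaled profile drops when
  \<open>N\<close> grows by one.\<close>

lemma profile_diff_ge:
  assumes "0 \<le> x'" "x' \<le> x" "0 < x"
  shows "(x\<^sup>2 - x'\<^sup>2) / 2 * (profile_density a b \<theta> x / x) \<le> profile a b \<theta> x - profile a b \<theta> x'"
  unfolding profile_diff [OF assms(1,2)]
proof (rule has_integral_le [OF has_integral_mult_left integrable_integral])
  show "((\<lambda>z. z) has_integral (x\<^sup>2 - x'\<^sup>2) / 2) {x'..x}"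
    using ident_has_integral [OF assms(2)] by (simp add: diff_divide_distrib)
qed (use assms profile_density_integrable profile_density_star in auto)

lemma profile_eq_square:
  assumes "0 \<le> z" "z \<le> b"
  shows "profile a b \<theta> z = z\<^sup>2 / a"
proof -
  have "profile a b \<theta> z = integral {0..z} (\<lambda>u. 2 / a * u)"
    unfolding profile_def
  proof (rule Henstock_Kurzweil_Integration.integral_cong)
    fix u assume u: "u \<in> {0..z}"
    then have "b * 1 \<le> b * exp (- \<theta> * (u - b))"
      using pos assms by (intro mult_left_mono) (auto simp: mult_nonneg_nonpos)
    then have "u \<le> b * exp (- \<theta> * (u - b))" using u assms by simp
    then show "profile_density a b \<theta> u = 2 / a * u" by (simp add: profile_density_def)
  qed
  also have "\<dots> = 2 / a * (z\<^sup>2 / 2)"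
    using has_integral_mult_right [OF ident_has_integral [OF assms(1)], of "2 / a"]
    by (intro integral_unique) simp
  finally show ?thesis by simp
qed

text \<open>The quadratic part contributes \<open>b^2 / a\<close>, the whole exponential tail at
  most \<open>2 * b / (a * \<theta>)\<close>.\<close>

lemma profile_le:
  assumes "0 \<le> z"
  shows "profile a b \<theta> z \<le> b\<^sup>2 / a + 2 * b / (a * \<theta>)"
proof (cases "z \<le> b")
  case True
  then have "profile a b \<theta> z \<le> b\<^sup>2 / a"
    using assms pos by (simp add: profile_eq_square divide_right_mono)
  then show ?thesis using pos by (simp add: add_increasing2)
next
  case False
  have "profile a b \<theta> z - profile a b \<theta> b = integral {b..z} (profile_density a b \<theta>)"
    using False pos by (intro profile_diff) auto
  also have "\<dots> \<le> (- 2 * b / (a * \<theta>) * exp (- \<theta> * (z - b))) - (- 2 * b / (a * \<theta>) * exp (- \<theta> * (b - b)))"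
  proof (rule has_integral_le [OF integrable_integral fundamental_theorem_of_calculus])
    fix u assume "u \<in> {b..z}"
    show "((\<lambda>u. - 2 * b / (a * \<theta>) * exp (- \<theta> * (u - b))) has_vector_derivative
        2 / a * (b * exp (- \<theta> * (u - b)))) (at u within {b..z})"
      using pos unfolding has_real_derivative_iff_has_vector_derivative [symmetric]
      by (auto intro!: derivative_eq_intros)
    show "profile_density a b \<theta> u \<le> 2 / a * (b * exp (- \<theta> * (u - b)))"
      unfolding profile_density_def using pos by (intro mult_left_mono) auto
  qed (use False profile_density_integrable in auto)
  also have "\<dots> \<le> 2 * b / (a * \<theta>)"
    using pos by simp
  finally show ?thesis using pos by (simp add: profile_eq_square)
qed

end

text \<open>The rescaled profile is a subsolution. At \<open>x = y / sqrt N\<close> with density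
  \<open>\<psi> \<le> 2 * x / a\<close>, half the deficit is at most
  \<open>\<psi>^2 * I / (2 * N)\<close>, where the kernel integral \<open>I\<close> tends to
  \<open>pi^2/6\<close>; the drop from \<open>N\<close> to \<open>N + 1\<close> is at least
  \<open>\<psi> * x / (2 * (N + 1))\<close>. Since \<open>a\<close> exceeds \<open>pi^2/3\<close>,
  the drop wins for large \<open>N\<close>.\<close>

lemma root_cdf_ge_profile:
  assumes a: "pi\<^sup>2 / 3 < a" and pos: "0 < b" "0 < \<theta>" and mass: "b\<^sup>2 / a + 2 * b / (a * \<theta>) \<le> 1"
  obtains N0 :: nat where "1 \<le> N0"
    "\<And>n x. log_primitive (\<lambda>y. profile a b \<theta> (y / sqrt (N0 + n))) x \<le> root_cdf n x"
proof -
  have a0: "0 < a" using a by (smt (verit) zero_le_power2 divide_nonneg_nonneg)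
  note facts = a0 pos
  let ?I = "\<lambda>N::nat. integral {0<..<1} (dilog_kernel (\<theta> / sqrt N))"
  have mu: "(\<lambda>N::nat. \<theta> / sqrt N) \<longlonglongrightarrow> 0" by real_asymp
  have "(\<lambda>N::nat. 2 * ?I N * ((real N + 1) / real N)) \<longlonglongrightarrow> 2 * (pi\<^sup>2 / 6) * 1"
  proof (intro tendsto_mult tendsto_const integral_dilog_kernel_tendsto mu)
    show "(\<lambda>N. (real N + 1) / real N) \<longlonglongrightarrow> 1" by real_asymp
  qed (use pos in auto)
  from order_tendstoD(2) [OF this, of a]
  have "\<forall>\<^sub>F N::nat in sequentially. 2 * ?I N * ((real N + 1) / real N) < a" using a by simp
  moreover have "\<forall>\<^sub>F N::nat in sequentially. \<theta> / sqrt N < 1 / 4"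
    by (rule order_tendstoD [OF mu]) simp
  \<comment> \<open>From \<open>N0\<close> on the drop beats the deficit, the rescaled rate
    \<open>\<theta> / sqrt N\<close> lies in the range of the majorant, and \<open>N\<close> is
    positive.\<close>
  ultimately have "\<forall>\<^sub>F N::nat in sequentially.
      2 * ?I N * ((real N + 1) / real N) < a \<and> \<theta> / sqrt N < 1 / 4 \<and> 1 \<le> N"
    using eventually_ge_at_top [of 1] by eventually_elim auto
  then obtain N0 where N0: "\<And>N. N0 \<le> N \<Longrightarrow> 2 * ?I N * ((real N + 1) / real N) < a"
    "\<And>N. N0 \<le> N \<Longrightarrow> \<theta> / sqrt N < 1 / 4" "\<And>N. N0 \<le> N \<Longrightarrow> 1 \<le> N"
    unfolding eventually_sequentially by blast
  define H where "H N y = profile a b \<theta> (y / sqrt N)" for N :: nat and y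
  define h where "h N y = profile_density a b \<theta> (y / sqrt N) / sqrt N" for N :: nat and y
  have step: "H (Suc N) y \<le> H N y - deficit (h N) (H N) (exp y) / 2"
    and reg: "continuous_on {0..} (h N)" "h N 0 = 0" "\<And>y. 0 \<le> y \<Longrightarrow> 0 \<le> h N y"
      "H N 0 = 0" "\<And>y. 0 \<le> y \<Longrightarrow> (H N has_real_derivative h N y) (at y within {0..})"
    if N: "N0 \<le> N" and y: "0 \<le> y" for N y
  proof -
    have N1: "1 \<le> N" "0 < sqrt N" using N0(3) [OF N] by auto
    show reg: "continuous_on {0..} (h N)" "h N 0 = 0" "\<And>y. 0 \<le> y \<Longrightarrow> 0 \<le> h N y" "H N 0 = 0"
      using N1 facts unfolding h_def H_def
      by (auto intro!: continuous_intros continuous_on_compose2 [OF continuous_profile_density]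
        divide_nonneg_nonneg profile_density_nonneg simp: profile_density_0 profile_0)
    show deriv: "(H N has_real_derivative h N y) (at y within {0..})" if "0 \<le> y" for y
    proof -
      have "((profile a b \<theta> \<circ> (\<lambda>y. y / sqrt N)) has_real_derivative
          profile_density a b \<theta> (y / sqrt N) * (1 / sqrt N)) (at y within {0..})"
      proof (rule DERIV_image_chain)
        show "(profile a b \<theta> has_real_derivative profile_density a b \<theta> (y / sqrt N))
            (at (y / sqrt N) within (\<lambda>y. y / sqrt N) ` {0..})"
          using that facts by (intro DERIV_subset [OF profile_deriv]) auto
      qed (rule DERIV_cdivide [OF DERIV_ident])
      then show ?thesis by (simp add: o_def H_def [abs_def] h_def)
    qed
    show "H (Suc N) y \<le> H N y - deficit (h N) (H N) (exp y) / 2"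
    \<comment> \<open>At \<open>y = 0\<close> everything vanishes; elsewhere the chord bound divides
      by \<open>x\<close>.\<close>
    proof (cases "y = 0")
      case True
      have "log_primitive (H N) 1 = 0" by (simp add: log_primitive_def reg)
      moreover have "integral {0..1} (\<lambda>u. log_density (h N) u * log_primitive (H N) (1 - u)) = integral {0..1} (\<lambda>_::real. 0)"
        by (intro Henstock_Kurzweil_Integration.integral_cong) (auto simp: log_primitive_def reg)
      ultimately show ?thesis using True facts by (simp add: deficit_def H_def profile_0)
    next
      case False
      define x where "x = y / sqrt N"
      have x: "0 < x" using False y N1 by (simp add: x_def)
      define \<psi> where "\<psi> = profile_density a b \<theta> x"
      have \<psi>: "0 \<le> \<psi>" "\<psi> \<le> 2 * x / a"
        using facts x by (auto simp: \<psi>_def profile_density_nonneg profile_density_le)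
      have "deficit (h N) (H N) (exp y) \<le> (h N y)\<^sup>2 * ?I N"
      proof (rule deficit_le [OF reg(1,2,3,4) deriv y])
        show "h N z \<le> h N y * exp (\<theta> / sqrt N * (y - z))" if "0 \<le> z" "z \<le> y" for z
        proof -
          have "profile_density a b \<theta> (z / sqrt N) \<le>
              profile_density a b \<theta> (y / sqrt N) * exp (\<theta> * (y / sqrt N - z / sqrt N))"
            using that N1 facts by (intro profile_density_decay) (auto simp: divide_right_mono)
          then have "profile_density a b \<theta> (z / sqrt N) / sqrt N \<le>
              profile_density a b \<theta> (y / sqrt N) * exp (\<theta> * (y / sqrt N - z / sqrt N)) / sqrt N"
            using N1 by (intro divide_right_mono) auto
          then show ?thesis by (simp add: h_def diff_divide_distrib [symmetric])
        qed
      qed (use pos N0(2) [OF N] in \<open>auto intro!: dilog_kernel_integrable\<close>)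
      also have "(h N y)\<^sup>2 * ?I N = \<psi> * (\<psi> * ?I N) / N"
        by (simp add: h_def \<psi>_def x_def power2_eq_square)
      also have "\<dots> \<le> \<psi> * (2 * x / a * ?I N) / N"
      proof -
        have "0 \<le> ?I N"
          using pos N0(2) [OF N] by (intro integral_nonneg dilog_kernel_integrable) (auto intro: dilog_kernel_nonneg)
        then show ?thesis using \<psi> by (intro divide_right_mono mult_left_mono mult_right_mono) auto
      qed
      also have "\<dots> \<le> \<psi> * x / (real N + 1)"
      proof -
        have "2 * ?I N / N \<le> a / (real N + 1)"
          using N0(1) [OF N] N1 by (simp add: field_simps)
        then have "\<psi> * x / a * (2 * ?I N / N) \<le> \<psi> * x / a * (a / (real N + 1))"
          using \<psi> x a0 by (intro mult_left_mono) auto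
        then show ?thesis using a0 by (simp add: field_simps)
      qed
      finally have 1: "deficit (h N) (H N) (exp y) / 2 \<le> \<psi> * x / (real N + 1) / 2"
        by (rule divide_right_mono) simp
      \<comment> \<open>\<open>x\<close> and \<open>x'\<close> are the rescaled positions of the
        same \<open>y\<close> at times \<open>N\<close> and \<open>N + 1\<close>.\<close>
      define x' where "x' = y / sqrt (Suc N)"
      have x': "0 \<le> x'" "x' \<le> x"
        using y N1 by (auto simp: x'_def x_def intro!: divide_left_mono)
      have "(x\<^sup>2 - x'\<^sup>2) / 2 * (\<psi> / x) = \<psi> * x / (real N + 1) / 2"
      proof -
        have "x'\<^sup>2 = y\<^sup>2 / (real N + 1)" "x\<^sup>2 = y\<^sup>2 / real N"
          by (simp_all add: x'_def x_def power_divide)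
        then have "x\<^sup>2 - x'\<^sup>2 = x\<^sup>2 / (real N + 1)"
          using N1 by (simp add: field_simps)
        then show ?thesis using x by (simp add: power2_eq_square)
      qed
      then have "\<psi> * x / (real N + 1) / 2 \<le> H N y - H (Suc N) y"
        using profile_diff_ge [OF facts x' x] by (simp add: H_def x_def x'_def \<psi>_def)
      with 1 show ?thesis by linarith
    qed
  qed
  have "log_primitive (H (N0 + n)) x \<le> root_cdf n x" for n x
  proof (induction n arbitrary: x)
    case 0
    show ?case
    proof (cases "1 \<le> x")
      case True
      \<comment> \<open>A single vertex has value 1, so its distribution function is 1 here and a
        total mass of at most 1 suffices.\<close>
      have "log_primitive (H N0) x \<le> b\<^sup>2 / a + 2 * b / (a * \<theta>)"
        unfolding log_primitive_def H_def using facts by (intro profile_le) auto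
      with mass True show ?thesis by (simp add: root_cdf_0)
    next
      case False
      then show ?thesis by (simp add: log_primitive_def H_def profile_0 facts root_cdf_0 max_def)
    qed
  next
    case (Suc n)
    show ?case
    proof (cases "1 \<le> x")
      case True
      have "log_primitive (H (Suc (N0 + n))) x \<le> log_primitive (H (N0 + n)) x - deficit (h (N0 + n)) (H (N0 + n)) x / 2"
        using step [of "N0 + n" "ln x"] True by (simp add: log_primitive_def)
      also have "\<dots> \<le> root_cdf (Suc n) x"
        using reg [of "N0 + n" 0] Suc by (intro root_cdf_Suc_ge) auto
      finally show ?thesis by simp
    next
      case False
      then show ?thesis by (simp add: log_primitive_def H_def profile_0 facts root_cdf_nonneg max_def)
    qed
  qed
  then show ?thesis using N0(3) [of N0] by (intro that [of N0]) (auto simp: H_def [abs_def])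
qed

lemma root_cdf_ge:
  assumes t: "0 < t" "t < 1" and a: "pi\<^sup>2 / 3 < a"
  obtains N0 :: nat where "1 \<le> N0"
    "\<And>N. 1 \<le> N \<Longrightarrow> t\<^sup>2 * (pi\<^sup>2 / 3) * N / (a * real (N0 + (N - 1)))
       \<le> root_cdf (N - 1) (exp (t * sqrt (pi\<^sup>2 / 3 * N)))"
proof -
  define c where "c = pi\<^sup>2 / 3"
  have c: "0 < c" "c < a" using a by (auto simp: c_def)
  \<comment> \<open>The point of interest, rescaled by \<open>sqrt (N0 + (N - 1))\<close>, is at
    most \<open>b\<close> because \<open>N0 \<ge> 1\<close>; so it falls in the quadratic part of
    the profile.\<close>
  define b where "b = t * sqrt c"
  have b: "0 < b" "b\<^sup>2 = t\<^sup>2 * c" using t c by (auto simp: b_def power_mult_distrib)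
  have "t\<^sup>2 * c < 1 * a"
    using t c by (intro mult_strict_mono) (auto simp: power_less_one_iff)
  then have m: "0 < 1 - b\<^sup>2 / a" using b c by (simp add: field_simps)
  \<comment> \<open>Solves \<open>b^2 / a + 2 * b / (a * \<theta>) = 1\<close>; it is positive
    because \<open>t < 1\<close> and \<open>c < a\<close> leave room for a tail.\<close>
  define \<theta> where "\<theta> = 2 * b / (a * (1 - b\<^sup>2 / a))"
  have \<theta>: "0 < \<theta>" using b c m by (simp add: \<theta>_def)
  have "a * \<theta> = 2 * b / (1 - b\<^sup>2 / a)"
    using c by (simp add: \<theta>_def)
  then have "2 * b / (a * \<theta>) = 1 - b\<^sup>2 / a"
    using b m by (simp only: divide_divide_eq_right) simp
  then have mass: "b\<^sup>2 / a + 2 * b / (a * \<theta>) \<le> 1" by simp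
  obtain N0 :: nat where N0: "1 \<le> N0"
    "\<And>n x. log_primitive (\<lambda>y. profile a b \<theta> (y / sqrt (N0 + n))) x \<le> root_cdf n x"
    using root_cdf_ge_profile [OF a b(1) \<theta> mass] by blast
  show ?thesis
  proof (rule that [OF N0(1)])
    fix N :: nat assume N: "1 \<le> N"
    define z where "z = t * sqrt (c * N) / sqrt (real (N0 + (N - 1)))"
    have z0: "0 \<le> z" using t c by (simp add: z_def)
    have zsq: "z\<^sup>2 = t\<^sup>2 * c * N / real (N0 + (N - 1))"
      using c by (simp add: z_def power_mult_distrib power_divide)
    have "t\<^sup>2 * c * N / real (N0 + (N - 1)) \<le> t\<^sup>2 * c * real (N0 + (N - 1)) / real (N0 + (N - 1))"
      using N N0(1) c by (intro divide_right_mono mult_left_mono) auto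
    also have "\<dots> = b\<^sup>2"
      using N0(1) b(2) by simp
    finally have "z\<^sup>2 \<le> b\<^sup>2" unfolding zsq .
    then have "z \<le> b" using b(1) by (auto intro: power2_le_imp_le)
    then have "profile a b \<theta> z = z\<^sup>2 / a"
      using z0 b c \<theta> by (intro profile_eq_square) auto
    moreover have "profile a b \<theta> z = log_primitive (\<lambda>y. profile a b \<theta> (y / sqrt (N0 + (N - 1)))) (exp (t * sqrt (c * N)))"
      using t c by (simp add: log_primitive_def z_def)
    ultimately have "z\<^sup>2 / a \<le> root_cdf (N - 1) (exp (t * sqrt (c * N)))"
      using N0(2) by metis
    then show "t\<^sup>2 * (pi\<^sup>2 / 3) * N / (a * real (N0 + (N - 1)))
       \<le> root_cdf (N - 1) (exp (t * sqrt (pi\<^sup>2 / 3 * N)))"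
      by (simp only: zsq c_def divide_divide_eq_left mult.commute [of a])
  qed
qed

section \<open>Upper bound for the distribution function\<close>

text \<open>\<open>log_primitive H\<close> may exceed 1 here; as \<open>z - z\<^sup>2/2\<close> is monotone only up to \<open>z = 1\<close>, this costs
  the last term.\<close>

lemma root_cdf_Suc_le:
  fixes h H :: "real \<Rightarrow> real"
  assumes h: "continuous_on {0..} h" "h 0 = 0" "\<And>y. 0 \<le> y \<Longrightarrow> 0 \<le> h y"
    and H: "H 0 = 0" "\<And>y. 0 \<le> y \<Longrightarrow> (H has_real_derivative h y) (at y within {0..})"
    and \<kappa>: "0 < \<kappa>" and le: "\<And>x. root_cdf n (x / \<kappa>) \<le> log_primitive H x"
  shows "root_cdf (Suc n) (x / \<kappa>) \<le>
    log_primitive H x - deficit h H x / 2 + (max 0 (log_primitive H x - 1))\<^sup>2 / 2"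
proof -
  let ?F = "root_cdf n (x / \<kappa>)" and ?G = "log_primitive H x"
  have "(\<Sum>k\<le>2^n. root_law n k * root_cdf n ((x - \<kappa> * real k) / \<kappa>))
      \<le> integral {0..x} (\<lambda>u. log_density h u * log_primitive H (x - u))"
  proof (rule convolution_le [OF _ _ _ continuous_log_density [OF h(1)] log_density_nonneg [OF h(3)]
        log_primitive_eq_integral [OF h(1,2) H] _ le])
    show "root_cdf n (x / \<kappa>) = (\<Sum>k\<le>2^n. root_law n k * of_bool (\<kappa> * real k \<le> x))" for x
      using \<kappa> by (simp add: root_cdf_def field_simps)
  qed (use \<kappa> in \<open>auto simp: root_law_nonneg\<close>)
  moreover have "(x - \<kappa> * real k) / \<kappa> = x / \<kappa> - real k" for k
    using \<kappa> by (simp add: field_simps)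
  moreover have "?F - ?F\<^sup>2 / 2 \<le> ?G - ?G\<^sup>2 / 2 + (max 0 (?G - 1))\<^sup>2 / 2"
  proof (cases "?G \<le> 1")
    case True
    have "0 \<le> (?G - ?F) * (2 - ?F - ?G)"
      using le [of x] True by (intro mult_nonneg_nonneg) auto
    then show ?thesis using True by (simp add: power2_eq_square algebra_simps)
  next
    case False
    have "0 \<le> (1 - ?F)\<^sup>2" by simp
    moreover have "max 0 (?G - 1) = ?G - 1" using False by simp
    ultimately show ?thesis by (simp add: power2_eq_square field_simps)
  qed
  ultimately show ?thesis
    unfolding root_cdf_Suc deficit_def by (simp add: field_simps)
qed

text \<open>With \<open>q = y^2 / (a * N)\<close>, half the deficit is for large \<open>y\<close>
  close to \<open>q / N\<close> times \<open>(pi^2/3) / a\<close>, a factor above 1, whereas the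
  quadratic drops only by \<open>q / (N + 1)\<close>. The surplus pays for the overshoot term of
  \<open>root_cdf_Suc_le\<close>.\<close>

lemma root_cdf_le:
  assumes a: "0 < a" "a < pi\<^sup>2 / 3"
  obtains N0 :: nat and K :: real where "1 \<le> N0" "0 < K"
    "\<And>n x. 1 \<le> x \<Longrightarrow> root_cdf n x \<le> (ln x + K)\<^sup>2 / (a * real (N0 + n))"
proof -
  \<comment> \<open>The gap between \<open>a\<close> and \<open>pi^2/3\<close> is shared out:
    \<open>J\<close> is what truncation keeps of the dilogarithm integral, \<open>\<rho>\<close> the
    fraction of \<open>y^2\<close> kept in \<open>(y + ln \<delta>)^2\<close>, and the remaining
    surplus is \<open>e > 0\<close>.\<close>
  obtain J where J: "a / 2 < J" "J < pi\<^sup>2 / 6"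
    using dense [of "a / 2" "pi\<^sup>2 / 6"] a by auto
  obtain \<delta> :: real where \<delta>: "0 < \<delta>" "\<delta> < 1" and "J < integral {\<delta>..1-\<delta>} (\<lambda>w. - ln (1 - w) / w)"
    using dilog_truncation [OF J(2)] .
  then have J_le: "J \<le> integral {\<delta>..1-\<delta>} (\<lambda>w. - ln (1 - w) / w)" by simp
  have J0: "0 < J" using J a by linarith
  have "a / (2 * J) < 1" using J J0 by simp
  then obtain \<rho> where \<rho>: "a / (2 * J) < \<rho>" "\<rho> < 1"
    using dense by blast
  have \<rho>0: "0 < \<rho>" using \<rho>(1) a J0 by (smt (verit) divide_pos_pos)
  define \<sigma> where "\<sigma> = sqrt \<rho>"
  have \<sigma>: "0 < \<sigma>" "\<sigma> < 1" "\<sigma>\<^sup>2 = \<rho>" using \<rho>0 \<rho> by (auto simp: \<sigma>_def)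
  define e where "e = 4 * \<rho> * J / a - 2"
  have e: "0 < e"
  proof -
    have "a < 2 * \<rho> * J" using \<rho>(1) J0 by (simp add: field_simps)
    then show ?thesis using a by (simp add: e_def field_simps)
  qed
  define N0 where "N0 = Suc (nat \<lceil>1 / e\<rceil>)"
  have N0: "1 \<le> N0" "1 / e \<le> N0" unfolding N0_def by linarith+
  \<comment> \<open>The three entries give positivity, the bound \<open>tail\<close> for
    \<open>y \<ge> K\<close>, and \<open>K^2 \<ge> a * N0\<close> for the start of the
    induction.\<close>
  define K where "K = max 1 (max (- ln \<delta> / (1 - \<sigma>)) (sqrt (a * N0)))"
  have K: "0 < K" "- ln \<delta> / (1 - \<sigma>) \<le> K" "sqrt (a * N0) \<le> K" by (auto simp: K_def)
  have tail: "\<sigma> * y \<le> y + ln \<delta>" if "K \<le> y" for y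
  proof -
    have "- ln \<delta> / (1 - \<sigma>) \<le> y" using K that by linarith
    then show ?thesis using \<sigma> by (simp add: field_simps)
  qed
  define H where "H N y = y\<^sup>2 / (a * real N)" for N :: nat and y
  define h where "h N y = 2 * y / (a * real N)" for N :: nat and y
  \<comment> \<open>Scaling the root value by \<open>\<kappa>\<close> shifts the logarithmic scale
    by \<open>K\<close>. Below \<open>\<kappa>\<close> the scaled distribution function is 0, so the
    recursion is checked for \<open>y \<ge> K\<close> only.\<close>
  define \<kappa> where "\<kappa> = exp K"
  have \<kappa>: "1 < \<kappa>" "0 < \<kappa>" using K by (auto simp: \<kappa>_def)
  have bound: "root_cdf n (x / \<kappa>) \<le> log_primitive (H (N0 + n)) x" for n x
  proof (induction n arbitrary: x)
    case 0
    show ?case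
    proof (cases "\<kappa> \<le> x")
      case True
      then have "0 < x" using \<kappa> by linarith
      with True have "K \<le> ln x" by (simp add: ln_ge_iff \<kappa>_def)
      have "a * N0 \<le> (ln x)\<^sup>2"
        by (rule sqrt_le_D) (use K \<open>K \<le> ln x\<close> in linarith)
      then have "1 \<le> (ln x)\<^sup>2 / (a * N0)" using a N0 by simp
      then show ?thesis using True \<kappa> by (simp add: root_cdf_0 log_primitive_def H_def)
    next
      case False
      then have "x / \<kappa> < 1" using \<kappa> by simp
      then show ?thesis using a by (simp add: root_cdf_less_1 log_primitive_def H_def)
    qed
  next
    case (Suc n)
    define N where "N = N0 + n"
    have N: "1 \<le> N" "1 / e \<le> N" using N0 by (auto simp: N_def)
    define y where "y = ln x"
    define q where "q = y\<^sup>2 / (a * N)"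
    show ?case
    proof (cases "\<kappa> \<le> x")
      case False
      then have "x / \<kappa> < 1" using \<kappa> by simp
      then show ?thesis using a by (simp add: root_cdf_less_1 log_primitive_def H_def)
    next
      case True
      have x: "1 < x" "exp y = x" using True \<kappa> by (auto simp: y_def)
      have y: "K \<le> y" "0 < y" using True \<kappa> K x unfolding y_def
        by (auto simp: ln_ge_iff \<kappa>_def intro: less_le_trans)
      have lp: "log_primitive (H N') x = y\<^sup>2 / (a * N')" for N'
        using x by (simp add: log_primitive_def H_def y_def)
      have goal: "log_primitive (H (N0 + Suc n)) x = y\<^sup>2 / (a * (real N + 1))"
        by (simp add: lp N_def)
      show ?thesis
      \<comment> \<open>A target of at least 1 is trivial; otherwise \<open>q\<close> overshoots 1
        by at most \<open>1 / N\<close>.\<close>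
      proof (cases "1 \<le> y\<^sup>2 / (a * (real N + 1))")
        case True
        then show ?thesis unfolding goal using root_cdf_le_1 order_trans by blast
      next
        case False
        have q: "q \<le> 1 + 1 / N"
        proof -
          have "y\<^sup>2 \<le> a * (real N + 1)"
            using False a by (simp add: not_le divide_less_eq mult_less_0_iff)
          then have "q \<le> a * (real N + 1) / (a * N)"
            unfolding q_def using a by (intro divide_right_mono) auto
          also have "\<dots> = 1 + 1 / N" using a N by (simp add: field_simps)
          finally show ?thesis .
        qed
        have "root_cdf (Suc n) (x / \<kappa>) \<le> log_primitive (H N) x - deficit (h N) (H N) x / 2
            + (max 0 (log_primitive (H N) x - 1))\<^sup>2 / 2"
        proof (rule root_cdf_Suc_le)
          show "continuous_on {0..} (h N)" "h N 0 = 0" "\<And>y. 0 \<le> y \<Longrightarrow> 0 \<le> h N y" "H N 0 = 0"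
            using a N unfolding h_def H_def by (auto intro!: continuous_intros)
          show "(H N has_real_derivative h N y) (at y within {0..})" for y
            using a N unfolding h_def H_def [abs_def] by (auto intro!: derivative_eq_intros)
        qed (use \<kappa> Suc in \<open>auto simp: N_def\<close>)
        then have 1: "root_cdf (Suc n) (x / \<kappa>) \<le> q - deficit (h N) (H N) x / 2 + (max 0 (q - 1))\<^sup>2 / 2"
          by (simp add: lp q_def)
        have 2: "(e + 2) * (q / N) \<le> deficit (h N) (H N) x"
        proof -
          have "\<sigma> * y \<le> y + ln \<delta>" by (rule tail [OF y(1)])
          then have "(\<sigma> * y)\<^sup>2 \<le> (y + ln \<delta>)\<^sup>2" using \<sigma> y by (intro power_mono) auto
          then have sq: "\<rho> * y\<^sup>2 \<le> (y + ln \<delta>)\<^sup>2" by (simp add: power_mult_distrib \<sigma>)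
          have "0 \<le> \<sigma> * y" using \<sigma> y by simp
          then have ly: "- ln \<delta> \<le> y" using tail [OF y(1)] by linarith
          have "(e + 2) * (q / N) = 4 * (\<rho> * y\<^sup>2) / (a * N)\<^sup>2 * J"
            using a N by (simp add: e_def q_def field_simps power2_eq_square)
          also have "\<dots> \<le> 4 * (y + ln \<delta>)\<^sup>2 / (a * N)\<^sup>2 * integral {\<delta>..1-\<delta>} (\<lambda>w. - ln (1 - w) / w)"
            using sq \<rho>0 J0 J_le by (intro mult_mono divide_right_mono) auto
          also have "\<dots> \<le> deficit (\<lambda>y. 2 * y / (a * N)) (\<lambda>y. y\<^sup>2 / (a * N)) (exp y)"
            using a N \<delta> ly by (intro deficit_square_ge) auto
          finally show ?thesis by (simp add: x h_def [abs_def] H_def [abs_def])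
        qed
        \<comment> \<open>The squared overshoot is at most \<open>1 / N^2\<close>, and
          \<open>N \<ge> 1 / e\<close> makes this at most \<open>e / N\<close>.\<close>
        have 3: "(max 0 (q - 1))\<^sup>2 \<le> e * (q / N)"
        proof (cases "q \<le> 1")
          case True
          have "0 \<le> q" using a by (simp add: q_def)
          then show ?thesis using True e by simp
        next
          case False
          have "(q - 1)\<^sup>2 \<le> (1 / N)\<^sup>2" using False q by (intro power_mono) auto
          also have "\<dots> = 1 / N * (1 / N)" by (simp add: power2_eq_square)
          also have "\<dots> \<le> e * (1 / N)"
            using N e by (intro mult_right_mono) (auto simp: field_simps)
          also have "\<dots> \<le> e * (q / N)"
            using False e by (intro mult_left_mono divide_right_mono) auto
          finally show ?thesis using False by simp
        qed
        have "q - q / N \<le> y\<^sup>2 / (a * (real N + 1))"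
        proof -
          have "q - q / N = q * ((real N - 1) / N)" using N by (simp add: field_simps)
          also have "\<dots> \<le> q * (N / (real N + 1))"
            using a N by (intro mult_left_mono) (auto simp: q_def field_simps)
          also have "\<dots> = y\<^sup>2 / (a * (real N + 1))" using a N by (simp add: q_def)
          finally show ?thesis .
        qed
        moreover have "(e + 2) * (q / N) = e * (q / N) + 2 * (q / N)"
          by (rule distrib_right)
        ultimately show ?thesis unfolding goal using 1 2 3 by linarith
      qed
    qed
  qed
  show ?thesis
  proof (rule that [OF N0(1) K(1)])
    fix n and x :: real assume x: "1 \<le> x"
    have "1 \<le> x * \<kappa>" using x \<kappa> mult_mono [of 1 x 1 \<kappa>] by simp
    then show "root_cdf n x \<le> (ln x + K)\<^sup>2 / (a * real (N0 + n))"
      using bound [of n "x * \<kappa>"] \<kappa> x by (simp add: log_primitive_def H_def ln_mult \<kappa>_def)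
  qed
qed

section \<open>The limit\<close>

text \<open>For each fixed \<open>a\<close> the two bounds tend to \<open>t^2 * c / a\<close>, from
  below when \<open>a > c\<close> and from above when \<open>a < c\<close>. Letting \<open>a\<close>
  approach \<open>c\<close> closes the gap.\<close>

lemma root_cdf_tendsto_square:
  assumes t: "0 < t" "t < 1"
  shows "(\<lambda>N. root_cdf (N - 1) (exp (t * sqrt (pi\<^sup>2 / 3 * N)))) \<longlonglongrightarrow> t\<^sup>2"
proof (rule order_tendstoI)
  define c where "c = pi\<^sup>2 / 3"
  have c: "0 < c" by (simp add: c_def)
  fix l assume l: "l < t\<^sup>2"
  have "((\<lambda>a. t\<^sup>2 * c / a) \<longlongrightarrow> t\<^sup>2 * c / c) (at_right c)"
    using c by (intro tendsto_intros) auto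
  then have "\<forall>\<^sub>F a in at_right c. l < t\<^sup>2 * c / a"
    using c l by (intro order_tendstoD(1)) auto
  moreover have "\<forall>\<^sub>F a in at_right c. c < a" by (rule eventually_at_right_less)
  ultimately obtain a where a: "l < t\<^sup>2 * c / a" "c < a"
    using eventually_happens' [OF trivial_limit_at_right_real] eventually_conj by blast
  obtain N0 :: nat where N0: "1 \<le> N0"
    "\<And>N. 1 \<le> N \<Longrightarrow> t\<^sup>2 * c * N / (a * real (N0 + (N - 1))) \<le> root_cdf (N - 1) (exp (t * sqrt (pi\<^sup>2 / 3 * N)))"
    using root_cdf_ge [OF t a(2) [unfolded c_def]] unfolding c_def by blast
  have "(\<lambda>N::nat. real N / (real N0 + (real N - 1))) \<longlonglongrightarrow> 1" by real_asymp
  then have "(\<lambda>N::nat. t\<^sup>2 * c / a * (real N / (real N0 + (real N - 1)))) \<longlonglongrightarrow> t\<^sup>2 * c / a * 1"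
    by (intro tendsto_intros)
  from order_tendstoD(1) [OF this, of l] a
  have "\<forall>\<^sub>F N::nat in sequentially. l < t\<^sup>2 * c / a * (real N / (real N0 + (real N - 1)))" by simp
  then show "\<forall>\<^sub>F N in sequentially. l < root_cdf (N - 1) (exp (t * sqrt (pi\<^sup>2 / 3 * N)))"
    using eventually_ge_at_top [of 1]
  proof eventually_elim
    case (elim N)
    then show ?case using N0(2) [of N] by (simp add: of_nat_diff add_diff_eq)
  qed
next
  define c where "c = pi\<^sup>2 / 3"
  have c: "0 < c" by (simp add: c_def)
  fix u assume u: "t\<^sup>2 < u"
  have "((\<lambda>a. t\<^sup>2 * c / a) \<longlongrightarrow> t\<^sup>2 * c / c) (at_left c)"
    using c by (intro tendsto_intros) auto
  then have "\<forall>\<^sub>F a in at_left c. t\<^sup>2 * c / a < u"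
    using c u by (intro order_tendstoD(2)) auto
  moreover have "\<forall>\<^sub>F a in at_left c. a \<in> {0<..<c}"
    using c by (rule eventually_at_left_real)
  ultimately obtain a where a: "t\<^sup>2 * c / a < u" "0 < a" "a < c"
    using eventually_happens' [OF trivial_limit_at_left_real] eventually_conj
    by (metis (no_types, lifting) greaterThanLessThan_iff)
  obtain N0 :: nat and K :: real where N0: "1 \<le> N0" "0 < K"
    "\<And>n x. 1 \<le> x \<Longrightarrow> root_cdf n x \<le> (ln x + K)\<^sup>2 / (a * real (N0 + n))"
    using root_cdf_le [OF a(2) a(3) [unfolded c_def]] by blast
  define d where "d = t * sqrt c"
  have d: "0 < d" "d\<^sup>2 = t\<^sup>2 * c" using t c by (auto simp: d_def power_mult_distrib)
  have "(\<lambda>N::nat. (d * sqrt (real N) + K)\<^sup>2 / (a * (real N0 + (real N - 1)))) \<longlonglongrightarrow> d\<^sup>2 * inverse a"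
    using d(1) a(2) by real_asymp
  then have "(\<lambda>N::nat. (t * sqrt (c * real N) + K)\<^sup>2 / (a * (real N0 + (real N - 1)))) \<longlonglongrightarrow> t\<^sup>2 * c / a"
    unfolding d(2) by (simp add: d_def real_sqrt_mult mult.assoc divide_inverse)
  from order_tendstoD(2) [OF this a(1)]
  show "\<forall>\<^sub>F N in sequentially. root_cdf (N - 1) (exp (t * sqrt (pi\<^sup>2 / 3 * N))) < u"
    using eventually_ge_at_top [of 1]
  proof eventually_elim
    case (elim N)
    then show ?case
      using N0(3) [of "exp (t * sqrt (c * N))" "N - 1"] t c by (simp add: of_nat_diff add_diff_eq flip: c_def)
  qed
qed

theorem theorem1:
  fixes M :: "nat \<Rightarrow> 'a measure"
    and \<eta> :: "nat \<Rightarrow> bool list \<Rightarrow> 'a \<Rightarrow> int"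
    and p c t :: real
  assumes "p = 1 / 2"
    and "c = pi\<^sup>2 / 3"
    and "\<And>N. N \<ge> 1 \<Longrightarrow> random_signs (M N) p N (\<eta> N)"
  shows "(\<lambda>N. \<P>(\<omega> in M N. 1 / sqrt (c * real N) * ln (real (root_value N (\<eta> N) \<omega>)) \<le> t))
           \<longlonglongrightarrow> (if t \<le> 0 then 0 else if t \<le> 1 then t\<^sup>2 else 1)"
proof -
  define f where "f s N = root_cdf (N - 1) (exp (s * sqrt (c * real N)))" for s and N :: nat
  have c: "0 < c" by (simp add: assms(2))
  have mid: "f s \<longlonglongrightarrow> s\<^sup>2" if "0 < s" "s < 1" for s
    using root_cdf_tendsto_square [OF that] by (simp add: f_def [abs_def] assms(2))
  have mono: "f s N \<le> f s' N" if "s \<le> s'" for s s' N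
    unfolding f_def using that c by (intro root_cdf_mono) (simp add: mult_right_mono)
  have "f t \<longlonglongrightarrow> (if t \<le> 0 then 0 else if t \<le> 1 then t\<^sup>2 else 1)"
  proof -
    \<comment> \<open>Only the open interval needs analysis: monotonicity in \<open>t\<close>
      carries values near 0 and near 1 to the two outer ranges.\<close>
    consider "t \<le> 0" | "0 < t" "t < 1" | "1 \<le> t" by linarith
    then show ?thesis
    proof cases
      case 1
      have "f t \<longlonglongrightarrow> 0"
      proof (rule order_tendstoI)
        fix u :: real assume u: "0 < u"
        \<comment> \<open>Chosen so that \<open>s^2 < s \<le> u\<close>.\<close>
        define s where "s = min (1 / 2) u"
        have s: "0 < s" "s < 1" "s \<le> u" using u by (auto simp: s_def)
        have "s * s < 1 * s" using s by (intro mult_strict_right_mono) auto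
        then have "s\<^sup>2 < u" using s unfolding power2_eq_square by linarith
        then have "\<forall>\<^sub>F N in sequentially. f s N < u" using mid [OF s(1,2)] by (rule order_tendstoD(2) [rotated])
        then show "\<forall>\<^sub>F N in sequentially. f t N < u"
          by eventually_elim (use 1 s mono [of t s] in \<open>auto intro: le_less_trans\<close>)
      qed (auto simp: f_def intro!: always_eventually less_le_trans [OF _ root_cdf_nonneg])
      then show ?thesis using 1 by simp
    next
      case 2
      then show ?thesis using mid by simp
    next
      case 3
      have "f t \<longlonglongrightarrow> 1"
      proof (rule order_tendstoI)
        fix l :: real assume l: "l < 1"
        have "((\<lambda>s. s\<^sup>2) \<longlongrightarrow> 1\<^sup>2) (at_left (1::real))" by (intro tendsto_intros)
        then have "\<forall>\<^sub>F s in at_left (1::real). l < s\<^sup>2" using l by (intro order_tendstoD(1)) auto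
        moreover have "\<forall>\<^sub>F s in at_left (1::real). s \<in> {0<..<1}" by (rule eventually_at_left_real) simp
        ultimately obtain s :: real where s: "l < s\<^sup>2" "0 < s" "s < 1"
          using eventually_happens' [OF trivial_limit_at_left_real] eventually_conj
          by (metis (no_types, lifting) greaterThanLessThan_iff)
        have "\<forall>\<^sub>F N in sequentially. l < f s N" using mid [OF s(2,3)] s(1) by (rule order_tendstoD(1))
        then show "\<forall>\<^sub>F N in sequentially. l < f t N"
          by eventually_elim (use 3 s mono [of s t] in \<open>auto intro: less_le_trans\<close>)
      qed (auto simp: f_def intro!: always_eventually le_less_trans [OF root_cdf_le_1])
      then show ?thesis using 3 by auto
    qed
  qed
  moreover have "\<forall>\<^sub>F N in sequentially. f t N =
      \<P>(\<omega> in M N. 1 / sqrt (c * real N) * ln (real (root_value N (\<eta> N) \<omega>)) \<le> t)"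
    using eventually_ge_at_top [of 1]
  proof eventually_elim
    case (elim N)
    interpret random_signs "M N" p N "\<eta> N" by (rule assms(3) [OF elim])
    have "1 / sqrt (c * real N) * ln (real (root_value N (\<eta> N) \<omega>)) \<le> t \<longleftrightarrow>
        real (root_value N (\<eta> N) \<omega>) \<le> exp (t * sqrt (c * real N))" for \<omega>
    proof -
      have "0 < sqrt (c * real N)" using elim c by simp
      then have "1 / sqrt (c * real N) * ln (real (root_value N (\<eta> N) \<omega>)) \<le> t \<longleftrightarrow>
          ln (real (root_value N (\<eta> N) \<omega>)) \<le> t * sqrt (c * real N)"
        by (simp add: divide_le_eq)
      moreover have "0 < real (root_value N (\<eta> N) \<omega>)"
        using tree_value_pos [of N "\<lambda>v. \<eta> N v \<omega>" "[]"] unfolding root_value_def by linarith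
      ultimately show ?thesis
        using exp_le_cancel_iff [of "ln (real (root_value N (\<eta> N) \<omega>))" "t * sqrt (c * real N)"] by simp
    qed
    then show ?case
      using prob_root_value_le [OF assms(1) elim, of "exp (t * sqrt (c * real N))"] by (simp add: f_def)
  qed
  ultimately show ?thesis by (rule Lim_transform_eventually)
qed

end
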